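(* Let $G$ be a unicyclic graph that is not a cycle, with unique cycle $C$ of length $s \ge 3$, whose vertices are identified with $\mathbb{Z}_s$ so that $i \sim i+1 \pmod s$ for $0 \le i \le s-1$. Let $R$ be the set of vertices of $C$ of degree at least $3$ in $G$, let $r = |R|$, and for $i \in R$ let $T_i$ be the tree in $G \setminus \{i-1,i+1\}$ that contains $i$ (that is, the component containing $i$). Then $$\mathrm{mp}(G) = \begin{cases} \ell(G)+2, & \text{if } r = 1,\\ \ell(G)+1, & \text{if } r = 2,\ R = \{i,j\} \text{ and either } T_i \text{ or } T_j \text{ is a path},\\ \ell(G)+1, & \text{if } r = 2 \text{ and } R = \{i,i+1\} \text{ for some } 0 \le i \le s-1,\\ \ell(G), & \text{otherwise.}\end{cases}$$
   Context: All graphs are finite, simple and undirected. A unicyclic graph is a connected graph containing exactly one cycle. $\ell(G)$ denotes the number of leaves (vertices of degree one) of $G$. A path $P$ in $G$ is monophonic (induced) if $G$ contains no edge between vertices that are non-consecutive on $P$. A set $M \subseteq V(G)$ is a monophonic position set (mp-set) if no three vertices of $M$ lie on a common monophonic path in $G$; $\mathrm{mp}(G)$ is the number of vertices in a largest mp-set of $G$.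
   Formalization: "T_i or T_j is a path" is read as: a path having i (resp. j) as an end-vertex; with i allowed in the interior the formula fails (C_4 with two leaves at each of two opposite vertices has mp = 4, not 5). *)

theory Defs
  imports "Graph_Theory.Graph_Theory"
begin

text \<open>
  A finite simple undirected graph is a \<^locale>\<open>pair_graph\<close>: a finite symmetric loop-free
  digraph without parallel arcs, in which an undirected edge is a pair of opposite arcs.
  Hence the degree of a vertex is its \<^const>\<open>out_degree\<close>.
\<close>

text \<open>
  The cycle graph with vertices \<open>c 0, \<dots>, c (s - 1)\<close> in this order, indices being read modulo \<open>s\<close>.
\<close>

definition cycle_graph :: "nat \<Rightarrow> (nat \<Rightarrow> 'a) \<Rightarrow> 'a pair_pre_digraph" where
  "cycle_graph s c =
     \<lparr> pverts = c ` {0..<s},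
       parcs = symcl ((\<lambda>i. (c i, c ((i + 1) mod s))) ` {0..<s}) \<rparr>"

definition cyclic_labelling :: "nat \<Rightarrow> (nat \<Rightarrow> 'a) \<Rightarrow> 'a pair_pre_digraph \<Rightarrow> bool" where
  "cyclic_labelling s c C \<longleftrightarrow> 3 \<le> s \<and> inj_on c {0..<s} \<and> C = cycle_graph s c"

definition is_cycle :: "'a pair_pre_digraph \<Rightarrow> bool" where
  "is_cycle C \<longleftrightarrow> (\<exists>s c. cyclic_labelling s c C)"

text \<open>
  Cycles of a graph are counted as subgraphs. (The library's \<open>pre_digraph.cycle\<close> is about closed
  arc walks; it distinguishes starting points and directions, and accepts an edge traversed
  back and forth.)
\<close>

definition cycle_of :: "'a pair_pre_digraph \<Rightarrow> 'a pair_pre_digraph \<Rightarrow> bool" where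
  "cycle_of G C \<longleftrightarrow> is_cycle C \<and> subgraph (with_proj C) (with_proj G)"

definition unicyclic :: "'a pair_pre_digraph \<Rightarrow> bool" where
  "unicyclic G \<longleftrightarrow>
     pair_graph G \<and> Digraph_Component.connected (with_proj G) \<and> (\<exists>!C. cycle_of G C)"

definition num_leaves :: "'a pair_pre_digraph \<Rightarrow> nat" where
  "num_leaves G = card {v \<in> pverts G. out_degree (with_proj G) v = 1}"

definition monophonic_path :: "'a pair_pre_digraph \<Rightarrow> 'a list \<Rightarrow> bool" where
  "monophonic_path G p \<longleftrightarrow> vpath p (with_proj G) \<and>
     (\<forall>i < length p. \<forall>j < length p. (p ! i, p ! j) \<in> parcs G \<longrightarrow> j = i + 1 \<or> i = j + 1)"

definition mp_set :: "'a pair_pre_digraph \<Rightarrow> 'a set \<Rightarrow> bool" where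
  "mp_set G M \<longleftrightarrow> M \<subseteq> pverts G \<and>
     \<not> (\<exists>S p. S \<subseteq> M \<and> card S = 3 \<and> monophonic_path G p \<and> S \<subseteq> set p)"

definition mp :: "'a pair_pre_digraph \<Rightarrow> nat" where
  "mp G = Max (card ` {M. mp_set G M})"

definition branch_indices :: "'a pair_pre_digraph \<Rightarrow> nat \<Rightarrow> (nat \<Rightarrow> 'a) \<Rightarrow> nat set" where
  "branch_indices G s c = {i \<in> {0..<s}. 3 \<le> out_degree (with_proj G) (c i)}"

text \<open>
  The component containing \<open>c i\<close> of the graph obtained by deleting the two neighbours of \<open>c i\<close> on
  the cycle. The index \<open>(i + s - 1) mod s\<close> is \<open>i - 1\<close> modulo \<open>s\<close> without truncated subtraction,
  and in a symmetric digraph the strong component \<open>scc_of\<close> is the component of the undirected graph.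
\<close>

definition hanging_tree ::
  "'a pair_pre_digraph \<Rightarrow> nat \<Rightarrow> (nat \<Rightarrow> 'a) \<Rightarrow> nat \<Rightarrow> ('a, 'a \<times> 'a) pre_digraph" where
  "hanging_tree G s c i =
     (let H = with_proj G \<restriction> (pverts G - {c ((i + s - 1) mod s), c ((i + 1) mod s)})
      in H \<restriction> pre_digraph.scc_of H (c i))"

definition path_graph :: "'a list \<Rightarrow> 'a pair_pre_digraph" where
  "path_graph p = \<lparr> pverts = set p, parcs = symcl (set (vwalk_arcs p)) \<rparr>"

text \<open>
  ``\<open>T\<close> is a path'' is meant for a tree rooted at its vertex \<open>u\<close> on the cycle: the path is pendant,
  starting at \<open>u\<close>. A path with \<open>u\<close> in its interior does not count. With such paths admitted the
  formula for the monophonic position number fails: take the 4-cycle on \<open>0, 1, 2, 3\<close> and attach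
  two leaves to each of \<open>0\<close> and \<open>2\<close>; the number is 4, the number of leaves, and not 5.
\<close>

definition is_path_from :: "'a \<Rightarrow> ('a, 'a \<times> 'a) pre_digraph \<Rightarrow> bool" where
  "is_path_from u T \<longleftrightarrow>
     (\<exists>p. p \<noteq> [] \<and> distinct p \<and> hd p = u \<and> T = with_proj (path_graph p))"

end

theory Submission
  imports Defs
begin

text \<open>
  Since the cycle \<open>C\<close> is unique, the edges outside \<open>C\<close> are exactly the edges from a vertex to its
  parent, one step closer to \<open>C\<close>: any other edge would close a second cycle. So \<open>G\<close> is a cycle
  with a rooted tree \<open>T u\<close> hanging at each vertex \<open>u\<close> of it. Let \<open>l u\<close> be the number of
  leaves of \<open>G\<close> in \<open>T u\<close>.

  Upper bound. Let \<open>M\<close> be an mp-set. If \<open>M\<close> contains a vertex \<open>m\<close> and a proper descendant of \<open>m\<close>,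
  then all of \<open>M\<close> lies below \<open>m\<close> and \<open>M - {m}\<close> is an antichain, so \<open>card M \<le> l u + 1\<close> for the root
  \<open>u\<close> of \<open>m\<close>. Otherwise \<open>M\<close> is an antichain. Let \<open>A\<close> be the set of roots of members of \<open>M\<close>; then
  \<open>M\<close> has at most \<open>l u\<close> members in \<open>T u\<close> for \<open>u \<in> A \<inter> R\<close> and one for \<open>u \<in> A - R\<close>, whence
  \<open>card M \<le> \<ell>(G) - (\<Sum>u\<in>R - A. l u) + card (A - R)\<close>. An element of \<open>A - R\<close> belongs to \<open>M\<close>, and
  going around the cycle through it shows that the other elements of \<open>A\<close> are pairwise adjacent.
  Hence \<open>card A \<le> 3\<close> if \<open>A - R\<close> is nonempty, and the bound follows by inspecting \<open>card R\<close>.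

  Lower bound. An inner vertex of a path is not a leaf, so the leaves form an mp-set. The extra
  elements are the two cycle neighbours of \<open>u \<in> R\<close>, taken together with the leaves of \<open>T u\<close> alone,
  or any further cycle vertex if \<open>R\<close> consists of two adjacent vertices.
\<close>

section \<open>Induced paths\<close>

text \<open>Counterpart of \<open>monophonic_path\<close> over a plain vertex set and relation; it
  admits the empty list, and edges are read off by index.\<close>

definition induced_path :: "'a set \<Rightarrow> 'a rel \<Rightarrow> 'a list \<Rightarrow> bool" where
  "induced_path V E p \<longleftrightarrow> set p \<subseteq> V \<and> distinct p \<and>
     (\<forall>i. Suc i < length p \<longrightarrow> (p ! i, p ! Suc i) \<in> E) \<and>
     (\<forall>i < length p. \<forall>j < length p. (p ! i, p ! j) \<in> E \<longrightarrow> j = Suc i \<or> i = Suc j)"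

text \<open>Counterpart of \<open>mp_set\<close>. Ordered positions single out the middle vertex
  \<open>p ! j\<close>, the one that the constructions below examine.\<close>

definition position_set :: "'a set \<Rightarrow> 'a rel \<Rightarrow> 'a set \<Rightarrow> bool" where
  "position_set V E M \<longleftrightarrow> M \<subseteq> V \<and>
     (\<forall>p i j k. induced_path V E p \<and> i < j \<and> j < k \<and> k < length p
        \<longrightarrow> \<not> (p ! i \<in> M \<and> p ! j \<in> M \<and> p ! k \<in> M))"

text \<open>A discrete intermediate value principle: it locates the edge by which a path leaves a
  set or, for a complement, enters one.\<close>

lemma walk_exit:
  fixes p :: "nat \<Rightarrow> 'a"
  assumes "i \<le> k" "p i \<in> X" "p k \<notin> X"
  obtains m where "i \<le> m" "m < k" "p m \<in> X" "p (Suc m) \<notin> X"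
proof -
  have "\<exists>m. i \<le> m \<and> m < k \<and> p m \<in> X \<and> p (Suc m) \<notin> X"
    using assms
  proof (induction k)
    case (Suc k)
    from Suc.prems have "i \<le> k" by (metis le_Suc_eq)
    show ?case
    proof (cases "p k \<notin> X")
      case True
      with Suc \<open>i \<le> k\<close> show ?thesis using less_Suc_eq by blast
    next
      case False
      with Suc.prems \<open>i \<le> k\<close> show ?thesis by (intro exI[of _ k]) auto
    qed
  qed auto
  then show ?thesis using that by blast
qed

text \<open>In a walk of least length inside \<open>W\<close>, a repetition or a chord would give a
  shortcut. A chord joins two vertices of \<open>W\<close> and so lies in \<open>W\<close> itself;
  hence the path is induced in the whole graph.\<close>

lemma shortest_walk_induced:
  assumes irr: "\<And>v. (v, v) \<notin> E" and sym: "sym E" and "W \<subseteq> V"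
    and xy: "(x, y) \<in> (E \<inter> W \<times> W)\<^sup>*" and "x \<in> W"
  obtains p where "induced_path V E p" "set p \<subseteq> W" "p \<noteq> []" "hd p = x" "last p = y"
proof -
  define F where "F = E \<inter> W \<times> W"
  define n where "n = (LEAST n. (x, y) \<in> F ^^ n)"
  have "\<exists>n. (x, y) \<in> F ^^ n" using xy unfolding F_def by (simp add: rtrancl_power)
  then have n: "(x, y) \<in> F ^^ n" unfolding n_def by (rule LeastI_ex)
  have min: "n \<le> m" if "(x, y) \<in> F ^^ m" for m
    unfolding n_def using that by (rule Least_le)
  from n obtain f where f: "f 0 = x" "f n = y" "\<And>i. i < n \<Longrightarrow> (f i, f (Suc i)) \<in> F"
    unfolding relpow_fun_conv by blast
  have seg: "(f i, f (i + k)) \<in> F ^^ k" if "i + k \<le> n" for i k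
    using that by (induction k) (auto intro!: f(3) relcompI)
  have inW: "f i \<in> W" if "i \<le> n" for i
    using f(1) f(3)[of "i - 1"] that \<open>x \<in> W\<close> unfolding F_def by (cases i) auto
  \<comment> \<open>Replacing the segment from \<open>f i\<close> to \<open>f j\<close> by a walk of
    length \<open>k\<close> cannot beat the minimum \<open>n\<close>. The case \<open>k = 1\<close>
    excludes chords, \<open>k = 0\<close> excludes repetitions.\<close>
  have short: "j \<le> i + k" if "i < j" "j \<le> n" "(f i, f j) \<in> F ^^ k" for i j k
  proof -
    have "(x, f i) \<in> F ^^ i" "(f j, y) \<in> F ^^ (n - j)"
      using seg[of 0 i] seg[of j "n - j"] f that by auto
    with that have "(x, y) \<in> F ^^ (i + k + (n - j))"
      unfolding relpow_add by blast
    with min that show ?thesis by fastforce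
  qed
  have step: "j = Suc i" if "i < j" "j \<le> n" "(f i, f j) \<in> E" for i j
  proof -
    have "(f i, f j) \<in> F" using that inW unfolding F_def by auto
    then have "(f i, f j) \<in> F ^^ 1" by simp
    with short that show ?thesis by (metis Suc_eq_plus1 Suc_leI le_antisym)
  qed
  have neq: "f i \<noteq> f j" if "i < j" "j \<le> n" for i j
    using short[of i j 0] that by auto
  have inj: "inj_on f {0..<Suc n}"
    by (rule inj_onI) (metis atLeastLessThan_iff less_Suc_eq_le linorder_neqE_nat neq)
  define p where "p = map f [0..<Suc n]"
  have nth: "p ! i = f i" if "i \<le> n" for i
    using that unfolding p_def by (simp add: nth_append del: upt_Suc)
  have len: "length p = Suc n" unfolding p_def by simp
  have sp: "set p \<subseteq> W" unfolding p_def using inW by (auto simp del: upt_Suc)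
  show ?thesis
  proof
    show "induced_path V E p"
      unfolding induced_path_def
    proof (intro conjI allI impI)
      show "set p \<subseteq> V" using sp \<open>W \<subseteq> V\<close> by blast
      show "distinct p" unfolding p_def using inj by (simp add: distinct_map del: upt_Suc)
      show "(p ! i, p ! Suc i) \<in> E" if "Suc i < length p" for i
        using that f(3)[of i] by (simp add: len nth F_def)
      fix i j assume "i < length p" "j < length p" "(p ! i, p ! j) \<in> E"
      then have ij: "i \<le> n" "j \<le> n" "(f i, f j) \<in> E" "(f j, f i) \<in> E"
        using sym by (auto simp: len nth dest: symD)
      then have "i \<noteq> j" using irr by auto
      then show "j = Suc i \<or> i = Suc j" using ij step by (meson linorder_neqE_nat)
    qed
    show "set p \<subseteq> W" by (rule sp)
    show ne: "p \<noteq> []" using len by auto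
    show "hd p = x" "last p = y"
      using len nth f(1,2) ne by (simp_all add: hd_conv_nth last_conv_nth)
  qed
qed

section \<open>A cycle with hanging trees\<close>

text \<open>The function \<open>par\<close> is constrained off the cycle only. The rank
  \<open>d\<close> falls from a vertex to its parent, so iterating \<open>par\<close> ends on the
  cycle. By \<open>E_eq\<close> there are no edges besides those of the cycle and those to
  parents.\<close>

locale cycle_with_trees =
  fixes V :: "'a set" and E :: "'a rel" and s :: nat and c :: "nat \<Rightarrow> 'a"
    and par :: "'a \<Rightarrow> 'a" and d :: "'a \<Rightarrow> nat"
  assumes fin: "finite V" and s3: "3 \<le> s" and inj: "inj_on c {0..<s}"
    and cyc_V: "c ` {0..<s} \<subseteq> V"
    and par_V: "\<And>v. v \<in> V - c ` {0..<s} \<Longrightarrow> par v \<in> V"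
    and par_d: "\<And>v. v \<in> V - c ` {0..<s} \<Longrightarrow> d (par v) < d v"
    and E_eq: "E = symcl ((\<lambda>i. (c i, c ((i + 1) mod s))) ` {0..<s}) \<union>
       symcl ((\<lambda>v. (v, par v)) ` (V - c ` {0..<s}))"
begin

abbreviation "Cy \<equiv> c ` {0..<s}"

definition parent :: "'a rel" where "parent = (\<lambda>v. (v, par v)) ` (V - Cy)"

definition subtree :: "'a \<Rightarrow> 'a set" where "subtree v = {w. (w, v) \<in> parent\<^sup>*}"

text \<open>Stated through the absence of children; \<open>card_nbrs_eq_1\<close> and
  \<open>card_nbrs_cyc\<close> relate this set and \<open>R\<close> to degrees.\<close>

definition leaves :: "'a set" where "leaves = {v \<in> V - Cy. \<forall>w. (w, v) \<notin> parent}"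

definition R :: "'a set" where "R = {u \<in> Cy. \<exists>w. (w, u) \<in> parent}"

lemma parent_iff: "(v, w) \<in> parent \<longleftrightarrow> v \<in> V \<and> v \<notin> Cy \<and> w = par v"
  by (auto simp: parent_def)

lemma parent_V: "(v, w) \<in> parent \<Longrightarrow> v \<in> V \<and> w \<in> V"
  using par_V by (auto simp: parent_iff)

lemma parent_d: "(v, w) \<in> parent \<Longrightarrow> d w < d v"
  using par_d by (auto simp: parent_iff)

lemma E_cases: "(u, v) \<in> E \<Longrightarrow> (u \<in> Cy \<and> v \<in> Cy) \<or> (u, v) \<in> parent \<or> (v, u) \<in> parent"
  using s3 by (auto simp: E_eq parent_def symcl_def)

lemma parent_E: "(u, v) \<in> parent \<Longrightarrow> (u, v) \<in> E \<and> (v, u) \<in> E"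
  by (auto simp: E_eq parent_def symcl_def image_iff)

lemma sym_E: "(u, v) \<in> E \<Longrightarrow> (v, u) \<in> E"
  by (auto simp: E_eq symcl_def image_iff)

lemma cyc_adj:
  assumes "i < s" "j < s"
  shows "(c i, c j) \<in> E \<longleftrightarrow>
    j = Suc i \<or> i = Suc j \<or> i = 0 \<and> Suc j = s \<or> j = 0 \<and> Suc i = s"
proof -
  have eq: "c a = c b \<longleftrightarrow> a = b" if "a < s" "b < s" for a b
    using inj that by (auto simp: inj_on_def)
  have "(c i, c j) \<in> E \<longleftrightarrow> j = (i + 1) mod s \<or> i = (j + 1) mod s"
    using assms eq[of _ i] eq[of _ j] eq[of i] eq[of j] s3
    by (auto simp: E_eq symcl_def image_iff)
  then show ?thesis using assms by (auto simp: mod_Suc)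
qed

lemma E_V: "(u, v) \<in> E \<Longrightarrow> u \<in> V \<and> v \<in> V"
  using E_cases[of u v] parent_V cyc_V by blast

lemma irrefl_E: "(v, v) \<notin> E"
proof
  assume "(v, v) \<in> E"
  then consider "v \<in> Cy" | "(v, v) \<in> parent" using E_cases by blast
  then show False
  proof cases
    case 1
    then obtain i where "i < s" "v = c i" by auto
    with cyc_adj[of i i] \<open>(v, v) \<in> E\<close> s3 show False by auto
  next
    case 2
    then show False using parent_d by blast
  qed
qed

lemma subtree_refl: "v \<in> subtree v"
  by (simp add: subtree_def)

lemma subtree_trans: "u \<in> subtree v \<Longrightarrow> v \<in> subtree w \<Longrightarrow> u \<in> subtree w"
  by (auto simp: subtree_def)

lemma subtree_V: "w \<in> subtree v \<Longrightarrow> v \<in> V \<Longrightarrow> w \<in> V"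
  unfolding subtree_def mem_Collect_eq by (induction rule: converse_rtrancl_induct) (auto dest: parent_V)

lemma subtree_less: "w \<in> subtree v \<Longrightarrow> w = v \<or> d v < d w"
  unfolding subtree_def mem_Collect_eq
  by (induction rule: rtrancl_induct) (auto dest: parent_d)

lemma subtree_antisym: "w \<in> subtree v \<Longrightarrow> v \<in> subtree w \<Longrightarrow> v = w"
  using subtree_less[of w v] subtree_less[of v w] by auto

lemma subtree_cyc: "w \<in> subtree v \<Longrightarrow> w \<in> Cy \<Longrightarrow> w = v"
  unfolding subtree_def mem_Collect_eq by (erule converse_rtranclE) (auto simp: parent_iff)

lemma subtree_par: "w \<in> subtree v \<Longrightarrow> w \<noteq> v \<Longrightarrow> w \<in> V - Cy \<and> par w \<in> subtree v"
  unfolding subtree_def mem_Collect_eq by (erule converse_rtranclE) (auto simp: parent_iff)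

text \<open>A vertex has at most one parent, so its ancestors form a chain.\<close>

lemma subtree_linear:
  assumes "w \<in> subtree u" "w \<in> subtree v"
  shows "u \<in> subtree v \<or> v \<in> subtree u"
proof -
  have "single_valued parent" by (auto simp: single_valued_def parent_iff)
  with assms show ?thesis
    unfolding subtree_def mem_Collect_eq using single_valued_confluent by fast
qed

text \<open>The neighbours of a vertex of the subtree other than \<open>m\<close> are its parent and
  its children, all in the subtree again. So paths enter and leave only through
  \<open>m\<close>.\<close>

lemma subtree_exit:
  assumes "(a, b) \<in> E" "a \<in> subtree m" "b \<notin> subtree m"
  shows "a = m"
proof (rule ccontr)
  assume ne: "a \<noteq> m"
  from subtree_par[OF assms(2) ne] have a: "a \<in> V - Cy" "par a \<in> subtree m" by auto
  from E_cases[OF assms(1)] a consider "b = par a" | "(b, a) \<in> parent" by (auto simp: parent_iff)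
  then show False
  proof cases
    case 1 with a assms show ?thesis by simp
  next
    case 2 with assms show ?thesis unfolding subtree_def by (auto intro: converse_rtrancl_into_rtrancl)
  qed
qed

lemma ex_root: "v \<in> V \<Longrightarrow> \<exists>u\<in>Cy. v \<in> subtree u"
proof (induction "d v" arbitrary: v rule: less_induct)
  case less
  show ?case
  proof (cases "v \<in> Cy")
    case True then show ?thesis using subtree_refl by blast
  next
    case False
    with less.prems less.hyps[of "par v"] par_V par_d obtain u where u: "u \<in> Cy" "par v \<in> subtree u" by blast
    moreover have "v \<in> subtree (par v)" using False less.prems by (auto simp: subtree_def parent_iff)
    ultimately show ?thesis using subtree_trans by blast
  qed
qed

lemma root_unique: "v \<in> subtree u \<Longrightarrow> v \<in> subtree w \<Longrightarrow> u \<in> Cy \<Longrightarrow> w \<in> Cy \<Longrightarrow> u = w"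
  using subtree_linear[of v u w] subtree_cyc[of u w] subtree_cyc[of w u] by auto

definition root :: "'a \<Rightarrow> 'a" where "root v = (THE u. u \<in> Cy \<and> v \<in> subtree u)"

lemma root: assumes "v \<in> V" shows "root v \<in> Cy" "v \<in> subtree (root v)"
proof -
  have "\<exists>!u. u \<in> Cy \<and> v \<in> subtree u" using ex_root[OF assms] root_unique by blast
  from theI'[OF this] show "root v \<in> Cy" "v \<in> subtree (root v)" unfolding root_def by auto
qed

lemma root_eq: "v \<in> subtree u \<Longrightarrow> u \<in> Cy \<Longrightarrow> root v = u"
  using root[of v] root_unique[of v "root v" u] subtree_V[of v u] cyc_V by auto

text \<open>A vertex of greatest rank in the subtree has no child. The second hypothesis excludes a
  bare cycle vertex, which is not in \<open>leaves\<close>.\<close>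

lemma ex_leaf:
  assumes "v \<in> V" "v \<notin> Cy \<or> v \<in> R"
  shows "\<exists>l\<in>leaves. l \<in> subtree v"
proof -
  have finD: "finite (subtree v)" using subtree_V[OF _ assms(1)] by (auto intro: finite_subset[OF _ fin])
  obtain w where w: "w \<in> subtree v" and max: "\<And>x. x \<in> subtree v \<Longrightarrow> d x \<le> d w"
  proof -
    have "Max (d ` subtree v) \<in> d ` subtree v" using finD subtree_refl[of v] by (intro Max_in) auto
    then obtain w where "w \<in> subtree v" "Max (d ` subtree v) = d w" by auto
    then show ?thesis using that finD by (metis Max_ge finite_imageI imageI)
  qed
  have nc: "(x, w) \<notin> parent" for x
  proof
    assume x: "(x, w) \<in> parent"
    then have "x \<in> subtree v" using w unfolding subtree_def by (auto intro: converse_rtrancl_into_rtrancl)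
    with max parent_d[OF x] show False by fastforce
  qed
  have "w \<notin> Cy" using subtree_cyc[OF w] nc assms(2) unfolding R_def by auto
  then have "w \<in> leaves" using subtree_V[OF w assms(1)] nc unfolding leaves_def by auto
  with w show ?thesis by blast
qed

lemma R_sub: "R \<subseteq> Cy" by (auto simp: R_def)

lemma root_in_R: assumes "v \<in> V - Cy" shows "root v \<in> R"
proof -
  have "(v, root v) \<in> parent\<^sup>*" "root v \<noteq> v" using root[of v] assms unfolding subtree_def by auto
  then obtain w where "(w, root v) \<in> parent" by (auto elim: rtranclE)
  then show ?thesis using root assms unfolding R_def by auto
qed

lemma subtree_trivial: "u \<in> Cy - R \<Longrightarrow> subtree u = {u}"
  unfolding subtree_def R_def by (auto elim: rtranclE)

lemma fin_R: "finite R" using R_sub finite_subset by blast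

lemma fin_leaves: "finite leaves" using fin by (auto simp: leaves_def)

lemma card_leaves: "card leaves = (\<Sum>u\<in>R. card (leaves \<inter> subtree u))"
proof -
  have "leaves = (\<Union>u\<in>R. leaves \<inter> subtree u)"
  proof
    show "leaves \<subseteq> (\<Union>u\<in>R. leaves \<inter> subtree u)"
    proof
      fix l assume l: "l \<in> leaves"
      then have "root l \<in> R" "l \<in> subtree (root l)" using root_in_R root by (simp_all add: leaves_def)
      with l show "l \<in> (\<Union>u\<in>R. leaves \<inter> subtree u)" by blast
    qed
  qed blast
  moreover have "card (\<Union>u\<in>R. leaves \<inter> subtree u) = (\<Sum>u\<in>R. card (leaves \<inter> subtree u))"
  proof (rule card_UN_disjoint)
    show "\<forall>u\<in>R. \<forall>w\<in>R. u \<noteq> w \<longrightarrow> leaves \<inter> subtree u \<inter> (leaves \<inter> subtree w) = {}"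
    proof (intro ballI impI)
      fix u w assume "u \<in> R" "w \<in> R" "u \<noteq> w"
      then have "x \<notin> subtree w" if "x \<in> subtree u" for x
        using root_unique[OF that, of w] R_sub by auto
      then show "leaves \<inter> subtree u \<inter> (leaves \<inter> subtree w) = {}" by blast
    qed
  qed (use fin_R fin_leaves in auto)
  ultimately show ?thesis by simp
qed

lemma card_leaves_ge_1: "u \<in> R \<Longrightarrow> 1 \<le> card (leaves \<inter> subtree u)"
  using ex_leaf[of u] R_sub cyc_V fin_leaves by (force simp: Suc_le_eq card_gt_0_iff)

end

section \<open>Position sets, subtrees and the spacing of roots on the cycle\<close>

lemma position_set_path:
  assumes "position_set V E M" "induced_path V E p" "p \<noteq> []"
    and "hd p \<in> M" "last p \<in> M" "y \<in> M" "y \<in> set p" "y \<noteq> hd p" "y \<noteq> last p"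
  shows False
proof -
  obtain j where j: "j < length p" "p ! j = y" using assms(7) by (auto simp: in_set_conv_nth)
  have h: "hd p = p ! 0" "last p = p ! (length p - 1)"
    using assms(3) by (auto simp: hd_conv_nth last_conv_nth)
  have "0 < j" using j h assms(8) by (metis gr0I)
  moreover have "j \<noteq> length p - 1" using j h assms(9) by metis
  ultimately have "0 < j" "j < length p - 1" "length p - 1 < length p" using j by auto
  with assms(1,2,4,5,6) h j show False unfolding position_set_def by metis
qed

lemma rtrancl_restrict_mono:
  "(x, y) \<in> (F \<inter> X \<times> X)\<^sup>* \<Longrightarrow> X \<subseteq> Y \<Longrightarrow> (x, y) \<in> (F \<inter> Y \<times> Y)\<^sup>*"
  by (rule subsetD[OF rtrancl_mono]) auto

context cycle_with_trees
begin

lemma sym_on_E: "sym E"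
  using sym_E by (auto intro: symI)

lemma sym_restrict: "(x, y) \<in> (E \<inter> X \<times> X)\<^sup>* \<Longrightarrow> (y, x) \<in> (E \<inter> X \<times> X)\<^sup>*"
proof -
  have "sym (E \<inter> X \<times> X)" using sym_E by (auto intro: symI)
  then show "(x, y) \<in> (E \<inter> X \<times> X)\<^sup>* \<Longrightarrow> (y, x) \<in> (E \<inter> X \<times> X)\<^sup>*"
    by (meson sym_rtrancl symD)
qed

lemma reach_subtree: "v \<in> subtree u \<Longrightarrow> (v, u) \<in> (E \<inter> subtree u \<times> subtree u)\<^sup>*"
  unfolding subtree_def mem_Collect_eq
proof (induction rule: converse_rtrancl_induct)
  case (step y z)
  then have "(y, z) \<in> E \<inter> subtree u \<times> subtree u"
    using parent_E by (auto simp: subtree_def intro: converse_rtrancl_into_rtrancl)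
  with step show ?case unfolding subtree_def by (auto intro: converse_rtrancl_into_rtrancl)
qed auto

lemma reach_cyc:
  assumes "i \<le> k" "k < s" "c ` {i..k} \<subseteq> X"
  shows "(c i, c k) \<in> (E \<inter> X \<times> X)\<^sup>*"
  using assms
proof (induction k rule: dec_induct)
  case (step n)
  have "c ` {i..n} \<subseteq> c ` {i..Suc n}" by (intro image_mono) auto
  with step have "(c i, c n) \<in> (E \<inter> X \<times> X)\<^sup>*" by auto
  moreover have "(c n, c (Suc n)) \<in> E \<inter> X \<times> X"
    using step by (auto simp: cyc_adj)
  ultimately show ?case by (rule rtrancl_into_rtrancl)
qed auto

lemma connected_V:
  assumes "u \<in> V" "v \<in> V" shows "(u, v) \<in> (E \<inter> V \<times> V)\<^sup>*"
proof -
  have "(w, c 0) \<in> (E \<inter> V \<times> V)\<^sup>*" if w: "w \<in> V" for w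
  proof -
    obtain i where i: "i < s" "root w = c i" using root(1)[OF w] by auto
    have "subtree (root w) \<subseteq> V" using subtree_V cyc_V root(1)[OF w] by blast
    then have "(w, c i) \<in> (E \<inter> V \<times> V)\<^sup>*"
      using rtrancl_restrict_mono[OF reach_subtree[OF root(2)[OF w]]] i by simp
    moreover have "c ` {0..i} \<subseteq> V" using cyc_V i by force
    then have "(c i, c 0) \<in> (E \<inter> V \<times> V)\<^sup>*" using reach_cyc[of 0 i V] i sym_restrict by blast
    ultimately show ?thesis by (rule rtrancl_trans)
  qed
  with assms show ?thesis using sym_restrict rtrancl_trans by metis
qed

lemma path_exits_subtree:
  assumes "induced_path V E p" "a \<le> b" "b < length p" "p ! a \<in> subtree m" "p ! b \<notin> subtree m"
  shows "\<exists>k. a \<le> k \<and> k < b \<and> p ! k = m"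
proof -
  obtain k where k: "a \<le> k" "k < b" "p ! k \<in> subtree m" "p ! Suc k \<notin> subtree m"
    using walk_exit[of a b "\<lambda>i. p ! i" "subtree m"] assms by auto
  then have "(p ! k, p ! Suc k) \<in> E" using assms by (auto simp: induced_path_def)
  with k subtree_exit show ?thesis by blast
qed

lemma path_enters_subtree:
  assumes "induced_path V E p" "a \<le> b" "b < length p" "p ! a \<notin> subtree m" "p ! b \<in> subtree m"
  shows "\<exists>k. a < k \<and> k \<le> b \<and> p ! k = m"
proof -
  obtain k where k: "a \<le> k" "k < b" "p ! k \<notin> subtree m" "p ! Suc k \<in> subtree m"
    using walk_exit[of a b "\<lambda>i. p ! i" "- subtree m"] assms by auto
  then have "(p ! Suc k, p ! k) \<in> E" using assms sym_E by (auto simp: induced_path_def)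
  with k subtree_exit show ?thesis by (metis Suc_leI le_imp_less_Suc)
qed

text \<open>An induced path from \<open>m'\<close> to a member outside the subtree leaves the
  subtree through \<open>m\<close>, so it would carry three members of \<open>M\<close>.\<close>

lemma position_set_below:
  assumes M: "position_set V E M" and m: "m \<in> M" "m' \<in> M" "m' \<in> subtree m" "m' \<noteq> m"
  shows "M \<subseteq> subtree m"
proof (rule subsetI, rule ccontr)
  fix v assume v: "v \<in> M" "v \<notin> subtree m"
  have "M \<subseteq> V" using M by (simp add: position_set_def)
  with m v have "m' \<in> V" "v \<in> V" by auto
  from shortest_walk_induced[OF irrefl_E sym_on_E order_refl connected_V[OF this] this(1)]
  obtain p where p: "induced_path V E p" "p \<noteq> []" "hd p = m'" "last p = v" by blast
  have h: "hd p = p ! 0" "last p = p ! (length p - 1)"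
    using p(2) by (auto simp: hd_conv_nth last_conv_nth)
  have "\<exists>k. 0 \<le> k \<and> k < length p - 1 \<and> p ! k = m"
    using p h m v by (intro path_exits_subtree) auto
  then have "m \<in> set p" by (auto simp: in_set_conv_nth) (metis less_diff_conv add_lessD1)
  moreover have "m \<noteq> v" using v subtree_refl by blast
  ultimately show False using position_set_path[OF M p(1,2), of m] p m v by auto
qed

text \<open>
  Deleting the tree at \<open>c q\<close>, where \<open>i < q < k\<close>, leaves a connected graph in which \<open>c 0\<close> separates
  \<open>x\<close> from \<open>z\<close>; a shortest path there is induced in the whole graph.
\<close>

lemma roots_consecutive:
  assumes M: "position_set V E M" and "c 0 \<in> M" "x \<in> M" "z \<in> M"
    and x: "x \<in> subtree (c i)" and z: "z \<in> subtree (c k)" and ik: "0 < i" "i < k" "k < s"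
  shows "k = Suc i"
proof (rule ccontr)
  assume "k \<noteq> Suc i"
  \<comment> \<open>The first index after \<open>i\<close>; by the assumption for contradiction it
    lies strictly before \<open>k\<close>.\<close>
  define q where "q = Suc i"
  have q: "0 < q" "i < q" "q < k" using ik \<open>k \<noteq> Suc i\<close> by (auto simp: q_def)
  define W where "W = V - subtree (c q)"
  have MV: "M \<subseteq> V" using M by (simp add: position_set_def)
  have ceq: "c a = c b \<longleftrightarrow> a = b" if "a < s" "b < s" for a b
    using inj that by (auto simp: inj_on_def)
  have cD: "c a \<in> subtree (c b) \<longleftrightarrow> a = b" if "a < s" "b < s" for a b
    using subtree_cyc[of "c a" "c b"] ceq that subtree_refl by auto
  have DD: "a = b" if "w \<in> subtree (c a)" "w \<in> subtree (c b)" "a < s" "b < s" for a b w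
    using root_unique[OF that(1,2)] that ceq by auto
  have cW: "c a \<in> W" if "a < s" "a \<noteq> q" for a
    using that cyc_V cD q ik by (auto simp: W_def)
  have DW: "subtree (c a) \<subseteq> W" if "a < s" "a \<noteq> q" for a
  proof
    fix w assume w: "w \<in> subtree (c a)"
    have "c a \<in> V" using cyc_V that by auto
    then show "w \<in> W" using subtree_V[OF w] DD[OF w, of q] that q ik by (auto simp: W_def)
  qed
  \<comment> \<open>The walk avoiding the tree at \<open>c q\<close>: up to \<open>c i\<close>, back
    to \<open>c 0\<close>, across to \<open>c (s - 1)\<close>, back to \<open>c k\<close> and down
    to \<open>z\<close>.\<close>
  have "(x, c i) \<in> (E \<inter> W \<times> W)\<^sup>*"
    using rtrancl_restrict_mono[OF reach_subtree[OF x] DW] q ik by auto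
  also have "(c i, c 0) \<in> (E \<inter> W \<times> W)\<^sup>*"
    using q ik by (intro sym_restrict[OF reach_cyc]) (auto intro!: cW)
  also have "(c 0, c (s - 1)) \<in> E \<inter> W \<times> W"
    using q ik s3 cW by (auto simp: cyc_adj)
  also have "(c (s - 1), c k) \<in> (E \<inter> W \<times> W)\<^sup>*"
    using q ik by (intro sym_restrict[OF reach_cyc]) (auto intro!: cW)
  also have "(c k, z) \<in> (E \<inter> W \<times> W)\<^sup>*"
    using sym_restrict[OF rtrancl_restrict_mono[OF reach_subtree[OF z] DW]] q ik by auto
  finally have xz: "(x, z) \<in> (E \<inter> W \<times> W)\<^sup>*" .
  have "x \<in> W" using x DW[of i] q ik by auto
  have "W \<subseteq> V" by (auto simp: W_def)
  from shortest_walk_induced[OF irrefl_E sym_on_E this xz \<open>x \<in> W\<close>]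
  obtain p where p: "induced_path V E p" "set p \<subseteq> W" "p \<noteq> []" "hd p = x" "last p = z" by blast
  have h: "hd p = p ! 0" "last p = p ! (length p - 1)"
    using p(3) by (auto simp: hd_conv_nth last_conv_nth)
  \<comment> \<open>The trees at \<open>c 1\<close> to \<open>c i\<close>. A path leaving
    \<open>X\<close> does so along a cycle edge, and as the tree at \<open>c q\<close> is deleted,
    that edge ends in \<open>c 0\<close>.\<close>
  define X where "X = (\<Union>j\<in>{1..<q}. subtree (c j))"
  have "p ! 0 \<in> X" using x p h ik by (auto simp: X_def q_def)
  moreover have "p ! (length p - 1) \<notin> X"
  proof
    assume "p ! (length p - 1) \<in> X"
    then obtain j where "j < q" "z \<in> subtree (c j)" using p h by (auto simp: X_def)
    with DD[OF z, of j] q ik show False by auto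
  qed
  ultimately obtain m where m: "m < length p - 1" "p ! m \<in> X" "p ! Suc m \<notin> X"
    using walk_exit[of 0 "length p - 1" "\<lambda>i. p ! i" X] by auto
  then have e: "(p ! m, p ! Suc m) \<in> E" using p(1) by (auto simp: induced_path_def)
  from m obtain j where j: "1 \<le> j" "j < q" "p ! m \<in> subtree (c j)" "p ! Suc m \<notin> subtree (c j)"
    by (auto simp: X_def)
  then have pm: "p ! m = c j" using subtree_exit[OF e] by blast
  have "p ! Suc m \<in> set p" using m by auto
  then have nW: "p ! Suc m \<in> W" using p(2) by blast
  have "p ! Suc m \<in> Cy"
  proof (rule ccontr)
    assume "p ! Suc m \<notin> Cy"
    with E_cases[OF e] pm j q ik have "(p ! Suc m, c j) \<in> parent" by (auto simp: parent_iff)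
    then show False using j(4) unfolding subtree_def by auto
  qed
  then obtain t where t: "t < s" "p ! Suc m = c t" by auto
  have "t = Suc j \<or> j = Suc t" using e t pm j q ik cyc_adj[of j t] by auto
  moreover have "t \<notin> {1..<q}" "t \<noteq> q"
    using m(3) t nW subtree_refl[of "c t"] by (auto simp: X_def W_def)
  ultimately have "t = 0" using j by auto
  with t m have "c 0 \<in> set p" by (metis \<open>p ! Suc m \<in> set p\<close>)
  moreover have "c 0 \<noteq> x" "c 0 \<noteq> z" using x z cD[of 0 i] cD[of 0 k] ik by auto
  ultimately show False using position_set_path[OF M p(1,3), of "c 0"] p assms by auto
qed

text \<open>Rotation brings an arbitrary cycle vertex to index 0, the place distinguished in
  \<open>roots_consecutive\<close>.\<close>

lemma rotate_labelling:
  assumes "b < s"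
  shows "cycle_with_trees V E s (\<lambda>j. c ((b + j) mod s)) par d"
    and "(\<lambda>j. c ((b + j) mod s)) ` {0..<s} = Cy"
proof -
  let ?r = "\<lambda>j. (b + j) mod s"
  have inj_r: "inj_on ?r {0..<s}"
    using assms by (auto intro!: inj_onI simp: mod_if split: if_splits)
  moreover have "?r ` {0..<s} \<subseteq> {0..<s}" using s3 by auto
  ultimately have im: "?r ` {0..<s} = {0..<s}" by (intro endo_inj_surj) auto
  have imc: "(\<lambda>j. f ((b + j) mod s)) ` {0..<s} = f ` {0..<s}" for f :: "nat \<Rightarrow> 'b"
    using im by (metis image_image)
  show eq: "(\<lambda>j. c (?r j)) ` {0..<s} = Cy" by (rule imc)
  have "(\<lambda>j. (c (?r j), c (?r ((j + 1) mod s)))) ` {0..<s}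
      = (\<lambda>j. (c (?r j), c ((?r j + 1) mod s))) ` {0..<s}"
    by (simp add: mod_simps add.assoc)
  also have "\<dots> = (\<lambda>i. (c i, c ((i + 1) mod s))) ` {0..<s}"
    by (rule imc)
  finally have eqE: "(\<lambda>j. (c (?r j), c (?r ((j + 1) mod s)))) ` {0..<s} =
    (\<lambda>i. (c i, c ((i + 1) mod s))) ` {0..<s}" .
  have inj': "inj_on (\<lambda>j. c (?r j)) {0..<s}"
    using comp_inj_on[OF inj_r, of c] im inj by (simp add: o_def)
  show "cycle_with_trees V E s (\<lambda>j. c (?r j)) par d"
    unfolding cycle_with_trees_def eq eqE
    using fin s3 inj' cyc_V par_V par_d E_eq by blast
qed

text \<open>After rotating \<open>b\<close> to index 0, \<open>roots_consecutive\<close> applies to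
  the two roots in whichever order their indices come.\<close>

lemma roots_adjacent:
  assumes M: "position_set V E M" and b: "b \<in> M" "b \<in> Cy" and x: "x \<in> M" and z: "z \<in> M"
    and ne: "root x \<noteq> b" "root z \<noteq> b" "root x \<noteq> root z"
  shows "(root x, root z) \<in> E"
proof -
  obtain n where n: "n < s" "b = c n" using b by auto
  define c' where "c' = (\<lambda>j. c ((n + j) mod s))"
  interpret rot: cycle_with_trees V E s c' par d unfolding c'_def by (rule rotate_labelling(1)[OF n(1)])
  have eq: "c' ` {0..<s} = Cy" unfolding c'_def by (rule rotate_labelling(2)[OF n(1)])
  \<comment> \<open>Parents depend on the labelling only through the set \<open>Cy\<close>, which
    rotation preserves.\<close>
  have "rot.parent = parent" unfolding rot.parent_def parent_def eq ..
  then have rD: "rot.subtree = subtree" unfolding rot.subtree_def subtree_def by simp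
  have b0: "b = c' 0" using n by (simp add: c'_def)
  have xz: "x \<in> V" "z \<in> V" using M x z by (auto simp: position_set_def)
  obtain i where i: "i < s" "root x = c' i" using root(1)[OF xz(1)] unfolding eq[symmetric] by auto
  obtain k where k: "k < s" "root z = c' k" using root(1)[OF xz(2)] unfolding eq[symmetric] by auto
  have sub: "x \<in> rot.subtree (c' i)" "z \<in> rot.subtree (c' k)" using root(2) xz i k rD by metis+
  have "0 < i" "0 < k" "i \<noteq> k" using ne i k b0 by (auto intro: gr0I)
  then have "k = Suc i \<or> i = Suc k"
    using rot.roots_consecutive[OF M _ x z sub] rot.roots_consecutive[OF M _ z x sub(2,1)] b b0 i k
    by (metis linorder_neqE_nat)
  then show ?thesis using rot.cyc_adj i k by auto
qed

text \<open>Three pairwise adjacent cycle vertices force \<open>s = 3\<close>. This turns the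
  adjacency of roots into a bound on their number.\<close>

lemma triangle_eq_Cy:
  assumes "u \<in> Cy" "v \<in> Cy" "w \<in> Cy" "u \<noteq> v" "v \<noteq> w" "u \<noteq> w"
    and "(u, v) \<in> E" "(v, w) \<in> E" "(u, w) \<in> E"
  shows "Cy = {u, v, w}"
proof -
  obtain i j k where ijk: "i < s" "j < s" "k < s" "u = c i" "v = c j" "w = c k"
    using assms by auto
  have "i \<noteq> j" "j \<noteq> k" "i \<noteq> k" using assms ijk by auto
  then have "s = 3" using assms ijk cyc_adj s3 by auto
  have "card Cy = 3" using card_image[OF inj] \<open>s = 3\<close> by simp
  moreover have "card {u, v, w} = 3" using assms by auto
  ultimately show ?thesis using assms by (intro card_subset_eq[symmetric]) auto
qed

section \<open>The monophonic position number of a cycle with hanging trees\<close>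

lemma card_antichain:
  assumes "X \<subseteq> subtree u" "u \<in> Cy" "\<And>x. x \<in> X \<Longrightarrow> x \<notin> Cy \<or> x \<in> R"
    and anti: "\<And>x y. x \<in> X \<Longrightarrow> y \<in> X \<Longrightarrow> y \<in> subtree x \<Longrightarrow> y = x"
  shows "card X \<le> card (leaves \<inter> subtree u)"
proof -
  have uV: "u \<in> V" using assms(2) cyc_V by auto
  have "\<exists>l. l \<in> leaves \<and> l \<in> subtree x" if "x \<in> X" for x
    using ex_leaf[of x] subtree_V[of x u] assms(1,3) that uV by blast
  \<comment> \<open>Choose a leaf below each member. A common leaf would make two members
    comparable, so the choice is injective.\<close>
  then obtain f where f: "\<And>x. x \<in> X \<Longrightarrow> f x \<in> leaves \<and> f x \<in> subtree x" by metis
  have "inj_on f X"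
  proof (rule inj_onI)
    fix x y assume "x \<in> X" "y \<in> X" "f x = f y"
    then have "x \<in> subtree y \<or> y \<in> subtree x" using subtree_linear[of "f x" x y] f[of x] f[of y] by auto
    then show "x = y" using anti[of x y] anti[of y x] \<open>x \<in> X\<close> \<open>y \<in> X\<close> by auto
  qed
  moreover have "f ` X \<subseteq> leaves \<inter> subtree u" using f assms(1) subtree_trans by blast
  ultimately show ?thesis using fin_leaves by (intro card_inj_on_le) auto
qed

lemma card_position_set_comparable:
  assumes M: "position_set V E M" and m: "m \<in> M" "m' \<in> M" "m' \<in> subtree m" "m' \<noteq> m"
  shows "\<exists>u\<in>R. card M \<le> card (leaves \<inter> subtree u) + 1"
proof
  have MV: "M \<subseteq> V" using M by (simp add: position_set_def)
  have MD: "M \<subseteq> subtree m" by (rule position_set_below[OF M m])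
  have m_root: "m \<in> subtree (root m)" "root m \<in> Cy" using root MV m by auto
  have "m' \<in> V - Cy" using subtree_par m by blast
  moreover have "root m' = root m" using root_eq subtree_trans m m_root by blast
  ultimately show "root m \<in> R" using root_in_R by metis
  have "card (M - {m}) \<le> card (leaves \<inter> subtree (root m))"
  proof (rule card_antichain)
    show "M - {m} \<subseteq> subtree (root m)" using MD m_root subtree_trans by blast
    show "root m \<in> Cy" by (rule m_root)
    show "x \<notin> Cy \<or> x \<in> R" if "x \<in> M - {m}" for x using subtree_par[of x m] MD that by auto
    show "y = x" if "x \<in> M - {m}" "y \<in> M - {m}" "y \<in> subtree x" for x y
    proof (rule ccontr)
      assume "y \<noteq> x"
      \<comment> \<open>A comparable pair with upper element \<open>x\<close> puts all of
        \<open>M\<close>, and so \<open>m\<close>, below \<open>x\<close>; as \<open>x\<close> is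
        below \<open>m\<close>, this gives \<open>x = m\<close>.\<close>
      then have "M \<subseteq> subtree x" using position_set_below[OF M] that by blast
      then have "m \<in> subtree x" "x \<in> subtree m" using MD m that by auto
      with subtree_antisym that show False by blast
    qed
  qed
  moreover have "finite M" using MV fin finite_subset by blast
  ultimately show "card M \<le> card (leaves \<inter> subtree (root m)) + 1" using m by simp
qed

text \<open>The formula on vertices: a tree that is a path becomes a tree with one leaf, consecutive
  indices become adjacent elements of \<open>R\<close>, and the two cases with value
  \<open>card leaves + 1\<close> are merged.\<close>

definition mp_value :: nat where
  "mp_value =
    (if card R = 1 then card leaves + 2
     else if card R = 2 \<and> ((\<exists>u\<in>R. card (leaves \<inter> subtree u) = 1) \<or> (\<exists>u\<in>R. \<exists>v\<in>R. (u, v) \<in> E))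
        then card leaves + 1
     else card leaves)"

lemma card_position_set:
  assumes M: "position_set V E M" and "R \<noteq> {}"
  shows "card M \<le> mp_value"
proof (cases "\<exists>m\<in>M. \<exists>m'\<in>M. m' \<in> subtree m \<and> m' \<noteq> m")
  case True
  then obtain u where u: "u \<in> R" "card M \<le> card (leaves \<inter> subtree u) + 1"
    using card_position_set_comparable[OF M] by blast
  have sum: "card leaves = card (leaves \<inter> subtree u) + (\<Sum>v\<in>R - {u}. card (leaves \<inter> subtree v))"
    unfolding card_leaves using fin_R u by (simp add: sum.remove)
  show ?thesis
  proof (cases "card R = 1")
    case True with sum u show ?thesis by (simp add: mp_value_def)
  next
    case False
    then have "R \<noteq> {u}" by auto
    \<comment> \<open>A second tree contributes a leaf, which offsets the extra element
      \<open>m\<close>.\<close>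
    then obtain v where v: "v \<in> R" "v \<noteq> u" using u by auto
    then have "1 \<le> (\<Sum>v\<in>R - {u}. card (leaves \<inter> subtree v))"
      using card_leaves_ge_1[of v] fin_R member_le_sum[of v "R - {u}" "\<lambda>v. card (leaves \<inter> subtree v)"] by force
    with sum u show ?thesis by (simp add: mp_value_def)
  qed
next
  case False
  then have anti: "y = x" if "x \<in> M" "y \<in> M" "y \<in> subtree x" for x y using that by blast
  have MV: "M \<subseteq> V" using M by (simp add: position_set_def)
  then have finM: "finite M" using fin finite_subset by blast
  define A where "A = root ` M"
  have finA: "finite A" using finM by (simp add: A_def)
  have AC: "A \<subseteq> Cy" using root MV by (auto simp: A_def)
  have in_M: "u \<in> M" if "u \<in> A - R" for u
  proof -
    from that obtain x where x: "x \<in> M" "u = root x" by (auto simp: A_def)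
    then have "x \<in> subtree u" using root MV by auto
    then have "x = u" using subtree_trivial[of u] AC that by auto
    with x(1) show ?thesis by simp
  qed
  have adj: "(u, v) \<in> E" if "b \<in> A - R" "u \<in> A - {b}" "v \<in> A - {b}" "u \<noteq> v" for b u v
  proof -
    from that obtain x z where "x \<in> M" "z \<in> M" "u = root x" "v = root z" by (auto simp: A_def)
    with roots_adjacent[OF M in_M[OF that(1)], of x z] that AC show ?thesis by auto
  qed
  \<comment> \<open>Any three elements of \<open>A - {b}\<close> are pairwise adjacent and would
    fill the cycle, leaving no place for \<open>b\<close>.\<close>
  have le3: "card A \<le> 3" if "A - R \<noteq> {}"
  proof (rule ccontr)
    assume "\<not> card A \<le> 3"
    from that obtain b where b: "b \<in> A - R" by blast
    then have "3 \<le> card (A - {b})" using \<open>\<not> card A \<le> 3\<close> finA by simp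
    then obtain B where "B \<subseteq> A - {b}" "card B = 3" by (meson obtain_subset_with_card_n)
    then obtain u v w where "{u, v, w} \<subseteq> A - {b}" "u \<noteq> v" "v \<noteq> w" "u \<noteq> w"
      by (auto simp: card_3_iff)
    then have "Cy = {u, v, w}" "b \<notin> {u, v, w}" using adj[OF b] AC triangle_eq_Cy[of u v w] by auto
    with b AC show False by auto
  qed
  \<comment> \<open>Each of three elements of \<open>A - R\<close> makes the other two adjacent, so
    they would fill the cycle, leaving no place for \<open>R\<close>.\<close>
  have le2: "card (A - R) \<le> 2"
  proof (rule ccontr)
    assume "\<not> card (A - R) \<le> 2"
    then have "3 \<le> card (A - R)" by simp
    then obtain B where "B \<subseteq> A - R" "card B = 3" by (meson obtain_subset_with_card_n)
    then obtain u v w where uvw: "{u, v, w} \<subseteq> A - R" "u \<noteq> v" "v \<noteq> w" "u \<noteq> w"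
      by (auto simp: card_3_iff)
    then have "Cy = {u, v, w}"
      using adj[of u v w] adj[of v u w] adj[of w u v] AC triangle_eq_Cy[of u v w] by auto
    with uvw R_sub \<open>R \<noteq> {}\<close> show False by auto
  qed
  let ?l = "\<lambda>u. card (leaves \<inter> subtree u)"
  have "card M = card (\<Union>u\<in>A. M \<inter> subtree u)"
  proof -
    have "M = (\<Union>u\<in>A. M \<inter> subtree u)" using root(2) MV by (force simp: A_def)
    then show ?thesis by metis
  qed
  also have "\<dots> \<le> (\<Sum>u\<in>A. card (M \<inter> subtree u))" by (rule card_UN_le[OF finA])
  also have "\<dots> = (\<Sum>u\<in>A \<inter> R. card (M \<inter> subtree u)) + (\<Sum>u\<in>A - R. card (M \<inter> subtree u))"
    by (rule sum.Int_Diff[OF finA])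
  also have "(\<Sum>u\<in>A \<inter> R. card (M \<inter> subtree u)) \<le> (\<Sum>u\<in>A \<inter> R. ?l u)"
  proof (rule sum_mono)
    fix u assume u: "u \<in> A \<inter> R"
    show "card (M \<inter> subtree u) \<le> ?l u"
    proof (rule card_antichain)
      show "x \<notin> Cy \<or> x \<in> R" if "x \<in> M \<inter> subtree u" for x using subtree_cyc[of x u] u that by auto
    qed (use u R_sub anti in auto)
  qed
  also have "(\<Sum>u\<in>A - R. card (M \<inter> subtree u)) \<le> (\<Sum>u\<in>A - R. 1)"
  proof (rule sum_mono)
    fix u assume "u \<in> A - R"
    then have "subtree u = {u}" using subtree_trivial AC by blast
    then show "card (M \<inter> subtree u) \<le> 1"
      by (metis card_mono card_1_singleton_iff One_nat_def finite.intros Int_lower2)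
  qed
  finally have le: "card M \<le> (\<Sum>u\<in>A \<inter> R. ?l u) + card (A - R)" by simp
  have split: "card leaves = (\<Sum>u\<in>A \<inter> R. ?l u) + (\<Sum>u\<in>R - A. ?l u)"
    unfolding card_leaves using sum.Int_Diff[OF fin_R, of ?l A] by (simp add: Int_commute)
  have ge: "card (R - A) \<le> (\<Sum>u\<in>R - A. ?l u)"
    using sum_mono[of "R - A" "\<lambda>_. 1" ?l] card_leaves_ge_1 by simp
  have cards: "card A = card (A \<inter> R) + card (A - R)" "card R = card (A \<inter> R) + card (R - A)"
    using finA fin_R by (metis card_Int_Diff) (metis card_Int_Diff fin_R Int_commute)
  have L_le: "card leaves \<le> mp_value" by (simp add: mp_value_def)
  have R0: "card R \<noteq> 0" using fin_R \<open>R \<noteq> {}\<close> by simp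
  \<comment> \<open>By \<open>le\<close> and \<open>split\<close>, \<open>card M\<close> exceeds
    \<open>card leaves\<close> by at most \<open>card (A - R)\<close> minus the leaves in trees at
    \<open>R - A\<close>. The gain is at most 2 by \<open>le2\<close>, there is none if
    \<open>A\<close> lies in \<open>R\<close>, and for \<open>card R\<close> at least 3 the bound
    \<open>le3\<close> gives \<open>card (A - R) \<le> card (R - A)\<close>.\<close>
  consider "card R = 1" | "A - R = {}" | "card R \<ge> 3" "A - R \<noteq> {}" | "card R = 2" "A - R \<noteq> {}"
    using R0 by linarith
  then show ?thesis
  proof cases
    case 1
    then show ?thesis using le split le2 by (simp add: mp_value_def)
  next
    case 2
    then have "card (A - R) = 0" by (metis card.empty)
    then show ?thesis using le split L_le by linarith
  next
    case 3
    then have "card (A - R) \<le> card (R - A)" using cards le3 by linarith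
    then show ?thesis using le split ge L_le by linarith
  next
    case 4
    \<comment> \<open>Two missed trees lose at least two leaves against a gain of at most 2. One
      missed tree leaves a net gain only if it has a single leaf. With none missed, \<open>b\<close>
      forces the two elements of \<open>R\<close> to be adjacent, and \<open>le3\<close> limits the
      gain to 1.\<close>
    consider "card (R - A) = 2" | "card (R - A) = 1" | "card (R - A) = 0"
      using cards 4 by linarith
    then show ?thesis
    proof cases
      case 1
      then show ?thesis using le split ge le2 L_le by linarith
    next
      case 2
      then obtain u where u: "R - A = {u}" by (metis card_1_singletonE)
      then have *: "card leaves = (\<Sum>u\<in>A \<inter> R. ?l u) + ?l u" using split by simp
      have "u \<in> R" using u by blast
      show ?thesis
      proof (cases "?l u = 1")
        case True
        then have "mp_value = card leaves + 1" using \<open>u \<in> R\<close> 4 by (auto simp: mp_value_def)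
        with True show ?thesis using le2 le * by linarith
      next
        case False
        then have "2 \<le> ?l u" using card_leaves_ge_1[OF \<open>u \<in> R\<close>] by linarith
        then show ?thesis using le2 le * L_le by linarith
      qed
    next
      case 3
      then have "R \<subseteq> A" using fin_R by auto
      obtain b where b: "b \<in> A - R" using 4 by blast
      obtain u v where uv: "R = {u, v}" "u \<noteq> v" using 4 by (auto simp: card_2_iff)
      then have "(u, v) \<in> E" using adj[OF b, of u v] b \<open>R \<subseteq> A\<close> by auto
      then have "mp_value = card leaves + 1" using 4 uv by (auto simp: mp_value_def)
      moreover have "card (A - R) \<le> 1" using cards le3 3 4 by linarith
      ultimately show ?thesis using le split by linarith
    qed
  qed
qed

section \<open>Lower bound by explicit position sets\<close>

lemma leaf_not_inner:
  assumes p: "induced_path V E p" and j: "i < j" "j < k" "k < length p" and l: "p ! j \<in> leaves"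
  shows False
proof -
  obtain h where h: "j = Suc h" using j(1) by (cases j) auto
  have "(p ! h, p ! j) \<in> E" "(p ! j, p ! Suc j) \<in> E"
    using p j h by (auto simp: induced_path_def)
  \<comment> \<open>A leaf has only its parent as neighbour, so the path would visit the parent on
    both sides of it.\<close>
  moreover have "w = par (p ! j)" if "(p ! j, w) \<in> E" for w
    using E_cases[OF that] l by (auto simp: leaves_def parent_iff)
  ultimately have "p ! h = p ! Suc j" using sym_E by metis
  then show False using p j h by (simp add: induced_path_def nth_eq_iff_index_eq)
qed

lemma position_set_leaves: "position_set V E leaves"
proof -
  have "leaves \<subseteq> V" by (auto simp: leaves_def)
  then show ?thesis unfolding position_set_def using leaf_not_inner by blast
qed

lemma induced_path_adj:
  "induced_path V E p \<Longrightarrow> a < length p \<Longrightarrow> b < length p \<Longrightarrow> (p ! a, p ! b) \<in> E \<Longrightarrow> b = Suc a \<or> a = Suc b"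
  by (simp add: induced_path_def)

lemma induced_path_nth_eq:
  "induced_path V E p \<Longrightarrow> a < length p \<Longrightarrow> b < length p \<Longrightarrow> p ! a = p ! b \<longleftrightarrow> a = b"
  by (simp add: induced_path_def nth_eq_iff_index_eq)

text \<open>A middle member of three is no leaf, so it is a cycle neighbour of \<open>u\<close>,
  outside the tree. Every leaf on the path then forces a visit to \<open>u\<close> on its own side
  of that neighbour.\<close>

lemma position_set_one_tree:
  assumes u: "u \<in> Cy" and x: "x \<in> Cy" "(u, x) \<in> E" and y: "y \<in> Cy" "(u, y) \<in> E"
  shows "position_set V E (leaves \<inter> subtree u \<union> {x, y})"
  unfolding position_set_def
proof (intro conjI allI impI notI)
  show "leaves \<inter> subtree u \<union> {x, y} \<subseteq> V" using x y cyc_V by (auto simp: leaves_def)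
  fix p i j k
  assume "induced_path V E p \<and> i < j \<and> j < k \<and> k < length p"
    and "p ! i \<in> leaves \<inter> subtree u \<union> {x, y} \<and> p ! j \<in> leaves \<inter> subtree u \<union> {x, y} \<and>
      p ! k \<in> leaves \<inter> subtree u \<union> {x, y}"
  then have p: "induced_path V E p" and ijk: "i < j" "j < k" "k < length p"
    and M: "p ! i \<in> leaves \<inter> subtree u \<union> {x, y}" "p ! j \<in> leaves \<inter> subtree u \<union> {x, y}"
      "p ! k \<in> leaves \<inter> subtree u \<union> {x, y}"
    by auto
  have nD: "x \<notin> subtree u" "y \<notin> subtree u" using subtree_cyc x y irrefl_E by auto
  have j: "p ! j \<in> {x, y}" using M(2) leaf_not_inner[OF p ijk] by auto
  have jE: "(u, p ! j) \<in> E" "p ! j \<notin> subtree u" using j x y nD by auto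
  have ne: "p ! i \<noteq> p ! j" "p ! j \<noteq> p ! k" "p ! i \<noteq> p ! k"
    using induced_path_nth_eq[OF p] ijk by auto
  have left: "\<exists>a. i \<le> a \<and> a < j \<and> p ! a = u" if "p ! i \<in> subtree u"
    using path_exits_subtree[OF p, of i j] that ijk jE by auto
  have right: "\<exists>b. j < b \<and> b \<le> k \<and> p ! b = u" if "p ! k \<in> subtree u"
    using path_enters_subtree[OF p, of j k] that ijk jE by auto
  \<comment> \<open>Two outer leaves make the path visit \<open>u\<close> twice. One outer leaf and
    the other cycle neighbour give a chord from \<open>u\<close> to that neighbour, across the
    middle vertex.\<close>
  consider "p ! i \<in> subtree u" "p ! k \<in> subtree u" | "p ! i \<in> subtree u" "(u, p ! k) \<in> E"
    | "p ! k \<in> subtree u" "(u, p ! i) \<in> E"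
    using M j ne x y by auto
  then show False
  proof cases
    case 1
    then obtain a b where "a < j" "p ! a = u" "j < b" "b \<le> k" "p ! b = u" using left right by blast
    then show False using induced_path_nth_eq[OF p, of a b] ijk by auto
  next
    case 2
    then obtain a where "a < j" "p ! a = u" using left by blast
    with 2 show False using induced_path_adj[OF p, of a k] ijk by auto
  next
    case 3
    then obtain b where "j < b" "b \<le> k" "p ! b = u" using right by blast
    with 3 show False using induced_path_adj[OF p, of b i] ijk by auto
  qed
qed

text \<open>Only \<open>w\<close> can be the middle member, so the path passes through a root in
  \<open>R\<close> on each side of it. Equal roots are a repetition, different ones are joined by a
  chord.\<close>

lemma position_set_adjacent_trees:
  assumes R: "R = {u, v}" and uv: "(u, v) \<in> E" and w: "w \<in> Cy" "w \<noteq> u" "w \<noteq> v"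
  shows "position_set V E (insert w leaves)"
  unfolding position_set_def
proof (intro conjI allI impI notI)
  show "insert w leaves \<subseteq> V" using w cyc_V by (auto simp: leaves_def)
  fix p i j k
  assume "induced_path V E p \<and> i < j \<and> j < k \<and> k < length p"
    and "p ! i \<in> insert w leaves \<and> p ! j \<in> insert w leaves \<and> p ! k \<in> insert w leaves"
  then have p: "induced_path V E p" and ijk: "i < j" "j < k" "k < length p"
    and M: "p ! i \<in> insert w leaves" "p ! j \<in> insert w leaves" "p ! k \<in> insert w leaves"
    by auto
  have j: "p ! j = w" using M(2) leaf_not_inner[OF p ijk] by auto
  have "p ! i \<in> leaves" "p ! k \<in> leaves"
    using M j induced_path_nth_eq[OF p, of i j] induced_path_nth_eq[OF p, of j k] ijk by auto
  moreover have "\<exists>r. r \<in> {u, v} \<and> l \<in> subtree r" if "l \<in> leaves" for l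
    using root_in_R[of l] root[of l] that R by (auto simp: leaves_def)
  ultimately obtain r t where rt: "r \<in> {u, v}" "t \<in> {u, v}" "p ! i \<in> subtree r" "p ! k \<in> subtree t" by meson
  have nD: "p ! j \<notin> subtree r" "p ! j \<notin> subtree t" using subtree_cyc[of w] w rt j by auto
  obtain a where a: "i \<le> a" "a < j" "p ! a = r" using path_exits_subtree[OF p, of i j r] rt nD ijk by auto
  obtain b where b: "j < b" "b \<le> k" "p ! b = t" using path_enters_subtree[OF p, of j k t] rt nD ijk by auto
  show False
  proof (cases "r = t")
    case True
    then show False using induced_path_nth_eq[OF p, of a b] a b ijk by auto
  next
    case False
    then have "(r, t) \<in> E" using rt uv sym_E by auto
    then show False using induced_path_adj[OF p, of a b] a b ijk by auto
  qed
qed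

lemma cyc_nbrs:
  assumes "u \<in> Cy"
  shows "\<exists>x y. x \<noteq> y \<and> {w \<in> Cy. (u, w) \<in> E} = {x, y}"
proof -
  obtain i where i: "i < s" "u = c i" using assms by auto
  define a where "a = (if Suc i = s then 0 else Suc i)"
  define b where "b = (if i = 0 then s - 1 else i - 1)"
  have ab: "a < s" "b < s" "a \<noteq> b" using i s3 by (auto simp: a_def b_def)
  have "(c i, c j) \<in> E \<longleftrightarrow> j = a \<or> j = b" if "j < s" for j
    unfolding cyc_adj[OF i(1) that] using i that s3 by (auto simp: a_def b_def)
  then have "{w \<in> Cy. (u, w) \<in> E} = {c a, c b}" using i ab by auto
  moreover have "c a \<noteq> c b" using inj ab by (auto simp: inj_on_def)
  ultimately show ?thesis by blast
qed

lemma ex_position_set: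
  assumes "R \<noteq> {}"
  shows "\<exists>M. position_set V E M \<and> card M = mp_value"
proof -
  have one: "\<exists>M. position_set V E M \<and> card M = card (leaves \<inter> subtree u) + 2" if u: "u \<in> R" for u
  proof -
    have "u \<in> Cy" using u R_sub by blast
    from cyc_nbrs[OF this] obtain x y where xy: "x \<noteq> y" "{w \<in> Cy. (u, w) \<in> E} = {x, y}"
      by blast
    then have mem: "x \<in> Cy" "(u, x) \<in> E" "y \<in> Cy" "(u, y) \<in> E" by blast+
    from \<open>u \<in> Cy\<close> have "position_set V E (leaves \<inter> subtree u \<union> {x, y})" using mem by (rule position_set_one_tree)
    moreover have "x \<notin> leaves" "y \<notin> leaves" using mem by (simp_all add: leaves_def)
    then have "card (leaves \<inter> subtree u \<union> {x, y}) = card (leaves \<inter> subtree u) + 2"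
      using xy fin_leaves by (subst card_Un_disjoint) auto
    ultimately show ?thesis by blast
  qed
  have "mp_value = card leaves"
    if "card R \<noteq> 1"
      "\<not> (card R = 2 \<and> ((\<exists>u\<in>R. card (leaves \<inter> subtree u) = 1) \<or> (\<exists>u\<in>R. \<exists>v\<in>R. (u, v) \<in> E)))"
    using that by (simp only: mp_value_def if_False)
  then consider (r1) "card R = 1"
    | (path) u where "card R = 2" "u \<in> R" "card (leaves \<inter> subtree u) = 1"
    | (adj) u v where "card R = 2" "u \<in> R" "v \<in> R" "(u, v) \<in> E"
    | (other) "mp_value = card leaves"
    by blast
  then show ?thesis
  proof cases
    case r1
    then obtain u where u: "R = {u}" by (metis card_1_singletonE)
    then have "card leaves = card (leaves \<inter> subtree u)" using card_leaves by simp
    with one[of u] u r1 show ?thesis by (auto simp: mp_value_def)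
  next
    case path
    from path(1) obtain a b where "R = {a, b}" "a \<noteq> b" by (auto simp: card_2_iff)
    with path(2) obtain v where v: "R = {u, v}" "u \<noteq> v" by (metis insertE insert_commute singletonD)
    \<comment> \<open>Giving up the only leaf at \<open>u\<close> costs 1, and the two cycle
      neighbours of \<open>v\<close> gain 2.\<close>
    then have "card leaves = 1 + card (leaves \<inter> subtree v)" using card_leaves path by simp
    moreover have "mp_value = card leaves + 1" using path by (auto simp: mp_value_def)
    ultimately show ?thesis using one[of v] v by auto
  next
    case adj
    then have "u \<noteq> v" using irrefl_E by auto
    then have uv: "R = {u, v}" using adj fin_R by (intro card_subset_eq[symmetric]) auto
    have "card {u, v} < card Cy" using card_image[OF inj] s3 by (simp add: card_insert_if)
    then have "\<not> Cy \<subseteq> {u, v}" by (meson card_mono finite.emptyI finite_insert leD)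
    then obtain w where w: "w \<in> Cy" "w \<noteq> u" "w \<noteq> v" by blast
    have "position_set V E (insert w leaves)" by (rule position_set_adjacent_trees[OF uv adj(4) w])
    moreover have "w \<notin> leaves" using w by (simp add: leaves_def)
    then have "card (insert w leaves) = card leaves + 1" using fin_leaves by simp
    moreover have "mp_value = card leaves + 1" using adj by (auto simp: mp_value_def)
    ultimately show ?thesis by metis
  next
    case other
    then show ?thesis using position_set_leaves by metis
  qed
qed

lemma Max_position_set:
  assumes "R \<noteq> {}"
  shows "Max (card ` {M. position_set V E M}) = mp_value"
proof (rule Max_eqI)
  have "{M. position_set V E M} \<subseteq> Pow V" by (auto simp: position_set_def)
  then show "finite (card ` {M. position_set V E M})" using fin finite_subset by blast
next
  show "n \<le> mp_value" if "n \<in> card ` {M. position_set V E M}" for n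
    using that card_position_set[OF _ assms] by auto
  show "mp_value \<in> card ` {M. position_set V E M}"
    using ex_position_set[OF assms] by (metis imageI mem_Collect_eq)
qed

end

section \<open>Unicyclic graphs\<close>

lemma set_vwalk_arcs_nth: "set (vwalk_arcs p) = {(p ! i, p ! Suc i) | i. Suc i < length p}"
proof (induction p rule: vwalk_arcs.induct)
  case (3 x y xs)
  have "{((x # y # xs) ! i, (x # y # xs) ! Suc i) | i. Suc i < length (x # y # xs)} =
    insert (x, y) {((y # xs) ! i, (y # xs) ! Suc i) | i. Suc i < length (y # xs)}" (is "?A = ?B")
  proof (intro equalityI subsetI)
    fix e assume "e \<in> ?A"
    then obtain i where "e = ((x # y # xs) ! i, (x # y # xs) ! Suc i)" "Suc i < length (x # y # xs)"
      by blast
    then show "e \<in> ?B" by (cases i) auto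
  next
    fix e assume "e \<in> ?B"
    then consider "e = (x, y)" | i where "e = ((y # xs) ! i, (y # xs) ! Suc i)" "Suc i < length (y # xs)"
      by blast
    then show "e \<in> ?A"
    proof cases
      case 1 then show ?thesis by (intro CollectI exI[of _ 0]) auto
    next
      case 2 then show ?thesis by (intro CollectI exI[of _ "Suc i"]) auto
    qed
  qed
  with 3 show ?case by simp
qed auto

section \<open>Degrees, pendant paths and hanging trees in terms of parents\<close>

context cycle_with_trees
begin

lemma cyc_succ:
  assumes "i < s" "j < s"
  shows "(c i, c j) \<in> E \<longleftrightarrow> j = (i + 1) mod s \<or> i = (j + 1) mod s"
  using assms s3 unfolding cyc_adj[OF assms] by (auto simp: mod_Suc)

text \<open>The degree of a cycle vertex is 2 plus the number of its children.\<close>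

lemma card_nbrs_cyc:
  assumes "u \<in> Cy"
  shows "3 \<le> card {w. (u, w) \<in> E} \<longleftrightarrow> u \<in> R"
proof -
  obtain x y where xy: "x \<noteq> y" "{w \<in> Cy. (u, w) \<in> E} = {x, y}" using cyc_nbrs[OF assms] by blast
  let ?K = "{w. (w, u) \<in> parent}"
  have "{w. (u, w) \<in> E} = {w \<in> Cy. (u, w) \<in> E} \<union> ?K"
    using E_cases[of u] parent_E assms by (auto simp: parent_iff)
  moreover have "{w \<in> Cy. (u, w) \<in> E} \<inter> ?K = {}" by (auto simp: parent_iff)
  moreover have finK: "finite ?K" using fin by (auto intro: finite_subset[of _ V] dest: parent_V)
  moreover have "card {w \<in> Cy. (u, w) \<in> E} = 2" using xy by simp
  ultimately have "card {w. (u, w) \<in> E} = 2 + card ?K"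
    by (simp add: card_Un_disjoint fin)
  then have "3 \<le> card {w. (u, w) \<in> E} \<longleftrightarrow> card ?K \<noteq> 0" by linarith
  then show ?thesis using assms finK by (auto simp: R_def)
qed

text \<open>Off the cycle the degree is 1 plus the number of children; on the cycle it is at least
  2.\<close>

lemma card_nbrs_eq_1:
  assumes "v \<in> V"
  shows "card {w. (v, w) \<in> E} = 1 \<longleftrightarrow> v \<in> leaves"
proof (cases "v \<in> Cy")
  case True
  obtain x y where xy: "x \<noteq> y" "{w \<in> Cy. (v, w) \<in> E} = {x, y}" using cyc_nbrs[OF True] by blast
  then have "{x, y} \<subseteq> {w. (v, w) \<in> E}" by blast
  moreover have "finite {w. (v, w) \<in> E}" using fin by (auto intro: finite_subset[of _ V] dest: E_V)
  ultimately have "2 \<le> card {w. (v, w) \<in> E}" using card_mono xy(1) by (metis card_2_iff)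
  then show ?thesis using True by (auto simp: leaves_def)
next
  case False
  let ?K = "{w. (w, v) \<in> parent}"
  have eq: "{w. (v, w) \<in> E} = insert (par v) ?K"
    using False assms E_cases[of v] parent_E parent_iff by blast
  have finK: "finite ?K" using fin by (auto intro: finite_subset[of _ V] dest: parent_V)
  have "par v \<notin> ?K"
  proof
    assume "par v \<in> ?K"
    then have "d v < d (par v)" using parent_d by blast
    then show False using par_d[of v] False assms by auto
  qed
  then have "card {w. (v, w) \<in> E} = Suc (card ?K)" using eq finK by simp
  then show ?thesis using False assms finK by (auto simp: leaves_def)
qed

text \<open>The path from \<open>u\<close> down to \<open>v\<close> runs through the ancestors of
  \<open>v\<close> below \<open>u\<close>; it is built by appending a vertex to the path to its
  parent. Its arcs point away from the root.\<close>

lemma tree_path: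
  assumes "v \<in> subtree u"
  shows "\<exists>p. p \<noteq> [] \<and> distinct p \<and> hd p = u \<and> last p = v \<and> set p = {w \<in> subtree u. v \<in> subtree w} \<and>
    set (vwalk_arcs p) = {(par w, w) | w. w \<in> set p - {u}}"
  using assms[unfolded subtree_def mem_Collect_eq]
proof (induction rule: converse_rtrancl_induct)
  case base
  have "{w \<in> subtree u. u \<in> subtree w} = {u}" using subtree_antisym subtree_refl by auto
  then show ?case by (intro exI[of _ "[u]"]) auto
next
  case (step y z)
  then obtain p where p: "p \<noteq> []" "distinct p" "hd p = u" "last p = z"
    "set p = {w \<in> subtree u. z \<in> subtree w}" "set (vwalk_arcs p) = {(par w, w) | w. w \<in> set p - {u}}" by blast
  have z: "z = par y" "y \<in> subtree z" "z \<in> subtree u" using step by (auto simp: parent_iff subtree_def)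
  have d: "d z < d y" using parent_d step by blast
  then have "z \<notin> subtree y" using subtree_less by fastforce
  have "y \<noteq> u" using subtree_less[OF z(3)] d by auto
  have sub: "y \<in> subtree w \<longleftrightarrow> w = y \<or> z \<in> subtree w" for w
    using subtree_par[of y w] subtree_trans[OF z(2), of w] subtree_refl z(1) by auto
  have "y \<in> subtree u" using z subtree_trans by blast
  then have set: "set (p @ [y]) = {w \<in> subtree u. y \<in> subtree w}" using p(5) sub by auto
  have "set (vwalk_arcs (p @ [y])) = insert (par y, y) (set (vwalk_arcs p))"
    using p z by (simp add: vwalk_arcs_append)
  also have "\<dots> = {(par w, w) | w. w \<in> set (p @ [y]) - {u}}"
    using p(6) \<open>y \<noteq> u\<close> by auto
  finally show ?case using p set \<open>z \<notin> subtree y\<close> by (intro exI[of _ "p @ [y]"]) auto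
qed

text \<open>On a path starting at \<open>u\<close>, a leaf can only be the last vertex: inner
  vertices have two neighbours, and \<open>u\<close> lies on the cycle. Conversely, the path down to
  a unique leaf exhausts the tree.\<close>

lemma is_path_from_iff:
  assumes G: "pverts G = V" "parcs G = E" and u: "u \<in> R"
  shows "is_path_from u (with_proj G \<restriction> subtree u) \<longleftrightarrow> card (leaves \<inter> subtree u) = 1"
proof -
  have uC: "u \<in> Cy" using u R_sub by blast
  have uV: "u \<in> V" using uC cyc_V by blast
  have T: "with_proj G \<restriction> subtree u = with_proj (path_graph p) \<longleftrightarrow>
    subtree u = set p \<and> {e \<in> E. fst e \<in> subtree u \<and> snd e \<in> subtree u} = symcl (set (vwalk_arcs p))" for p
    unfolding induce_subgraph_def with_proj_def path_graph_def G[symmetric] by simp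
  show ?thesis
  proof
    assume "is_path_from u (with_proj G \<restriction> subtree u)"
    then obtain p where p: "p \<noteq> []" "distinct p" "hd p = u" "subtree u = set p"
      and E: "{e \<in> E. fst e \<in> subtree u \<and> snd e \<in> subtree u} = symcl (set (vwalk_arcs p))"
      unfolding is_path_from_def T by blast
    have arcs: "(p ! i, p ! Suc i) \<in> E" if "Suc i < length p" for i
    proof -
      have "(p ! i, p ! Suc i) \<in> symcl (set (vwalk_arcs p))"
        using that by (auto simp: set_vwalk_arcs_nth symcl_def)
      then show ?thesis using E by blast
    qed
    have "x = last p" if x: "x \<in> leaves \<inter> subtree u" for x
    proof (rule ccontr)
      assume "x \<noteq> last p"
      obtain k where k: "k < length p" "p ! k = x" using x p by (auto simp: in_set_conv_nth)
      have "k \<noteq> 0" using k x p uC by (auto simp: leaves_def hd_conv_nth)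
      then obtain h where h: "k = Suc h" by (cases k) auto
      have "Suc k < length p" using k \<open>x \<noteq> last p\<close> p(1)
        by (metis Suc_lessI diff_Suc_1 last_conv_nth)
      then have "(x, p ! h) \<in> E" "(x, p ! Suc k) \<in> E" using arcs[of h] arcs[of k] h k sym_E by auto
      moreover have "w = par x" if "(x, w) \<in> E" for w
        using E_cases[OF that] x by (auto simp: leaves_def parent_iff)
      ultimately have "p ! h = p ! Suc k" by metis
      then show False using p(2) h \<open>Suc k < length p\<close> by (simp add: nth_eq_iff_index_eq)
    qed
    then have "card (leaves \<inter> subtree u) \<le> card {last p}" by (intro card_mono) auto
    then show "card (leaves \<inter> subtree u) = 1" using card_leaves_ge_1[OF u] by simp
  next
    assume "card (leaves \<inter> subtree u) = 1"
    then obtain l where l: "leaves \<inter> subtree u = {l}" by (metis card_1_singletonE)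
    then obtain p where p: "p \<noteq> []" "distinct p" "hd p = u" "set p = {w \<in> subtree u. l \<in> subtree w}"
      "set (vwalk_arcs p) = {(par w, w) | w. w \<in> set p - {u}}" using tree_path[of l u] by blast
    \<comment> \<open>Below \<open>w\<close> there is some leaf, necessarily \<open>l\<close>; so
      \<open>w\<close> is an ancestor of \<open>l\<close> and lies on \<open>p\<close>.\<close>
    have "l \<in> subtree w" if w: "w \<in> subtree u" for w
    proof (cases "w = u")
      case True then show ?thesis using l by blast
    next
      case False
      then have "w \<in> V - Cy" using subtree_par w by blast
      then obtain l' where "l' \<in> leaves" "l' \<in> subtree w" using ex_leaf[of w] by blast
      moreover from this have "l' \<in> leaves \<inter> subtree u" using w subtree_trans by blast
      then have "l' = l" unfolding l by simp
      ultimately show ?thesis by simp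
    qed
    then have set: "subtree u = set p" using p(4) by auto
    have "{e \<in> E. fst e \<in> subtree u \<and> snd e \<in> subtree u} = symcl {(par w, w) | w. w \<in> subtree u - {u}}"
    proof (rule set_eqI)
      fix e :: "'a \<times> 'a"
      obtain a b where e: "e = (a, b)" by (cases e)
      have sym: "e \<in> symcl {(par w, w) | w. w \<in> subtree u - {u}} \<longleftrightarrow>
        (a = par b \<and> b \<in> subtree u - {u} \<or> b = par a \<and> a \<in> subtree u - {u})"
        unfolding e symcl_def by (auto simp: image_iff)
      show "e \<in> {e \<in> E. fst e \<in> subtree u \<and> snd e \<in> subtree u} \<longleftrightarrow> e \<in> symcl {(par w, w) | w. w \<in> subtree u - {u}}"
        unfolding sym
      proof
        assume "e \<in> {e \<in> E. fst e \<in> subtree u \<and> snd e \<in> subtree u}"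
        then have ab: "(a, b) \<in> E" "a \<in> subtree u" "b \<in> subtree u" using e by auto
        consider "a \<in> Cy" "b \<in> Cy" | "(a, b) \<in> parent" | "(b, a) \<in> parent" using E_cases[OF ab(1)] by blast
        then show "a = par b \<and> b \<in> subtree u - {u} \<or> b = par a \<and> a \<in> subtree u - {u}"
        proof cases
          case 1
          then show ?thesis using subtree_cyc ab irrefl_E by metis
        qed (use ab uC in \<open>auto simp: parent_iff\<close>)
      next
        assume "a = par b \<and> b \<in> subtree u - {u} \<or> b = par a \<and> a \<in> subtree u - {u}"
        then have "((b, a) \<in> parent \<or> (a, b) \<in> parent) \<and> a \<in> subtree u \<and> b \<in> subtree u"
          using subtree_par[of b u] subtree_par[of a u] by (auto simp: parent_iff)
        then show "e \<in> {e \<in> E. fst e \<in> subtree u \<and> snd e \<in> subtree u}" using parent_E e by auto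
      qed
    qed
    then show "is_path_from u (with_proj G \<restriction> subtree u)"
      unfolding is_path_from_def T using p(1,2,3,5) set by (intro exI[of _ p]) simp
  qed
qed

text \<open>An edge leaving the subtree starts at \<open>c i\<close> and leads to one of its two
  cycle neighbours, which are deleted; inside the subtree every vertex is connected to
  \<open>c i\<close>.\<close>

lemma hanging_tree_eq:
  assumes G: "pverts G = V" "parcs G = E" and i: "i < s"
  shows "hanging_tree G s c i = with_proj G \<restriction> subtree (c i)"
proof -
  define S where "S = V - {c ((i + s - 1) mod s), c ((i + 1) mod s)}"
  define H where "H = with_proj G \<restriction> S"
  let ?u = "c i"
  have uC: "?u \<in> Cy" using i by auto
  have ends: "arcs_ends H = E \<inter> S \<times> S"
    unfolding H_def arcs_ends_conv by (auto simp: G image_iff)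
  have vH: "verts H = S" by (simp add: H_def)
  have nbr: "(?u, c ((i + s - 1) mod s)) \<in> E" "(?u, c ((i + 1) mod s)) \<in> E"
    using i s3 cyc_succ[of i "(i + s - 1) mod s"] cyc_succ[of i "(i + 1) mod s"]
    by (auto simp: mod_simps)
  have nbr': "w = c ((i + s - 1) mod s) \<or> w = c ((i + 1) mod s)" if w: "w \<in> Cy" "(?u, w) \<in> E" for w
  proof -
    obtain t where t: "t < s" "w = c t" using w by auto
    have "t = (i + 1) mod s \<or> i = (t + 1) mod s" using w(2) t cyc_succ[OF i t(1)] by simp
    moreover have "(((t + 1) mod s) + s - 1) mod s = t" using t by (auto simp: mod_Suc)
    ultimately show ?thesis using t by auto
  qed
  have DS: "subtree ?u \<subseteq> S"
  proof
    fix w assume w: "w \<in> subtree ?u"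
    have "w \<in> V" using subtree_V[OF w] uC cyc_V by auto
    moreover have "w \<notin> Cy \<or> w = ?u" using subtree_cyc[OF w] by blast
    moreover have "(i + s - 1) mod s < s" "(i + 1) mod s < s" using s3 by auto
    ultimately show "w \<in> S" using nbr irrefl_E by (auto simp: S_def)
  qed
  have scc: "pre_digraph.scc_of H ?u = subtree ?u"
  proof (intro equalityI subsetI)
    fix v assume "v \<in> pre_digraph.scc_of H ?u"
    then have "(?u, v) \<in> rtrancl_on S (E \<inter> S \<times> S)"
      by (simp add: pre_digraph.scc_of_def reachable_def ends vH)
    then show "v \<in> subtree ?u"
    proof (induction rule: rtrancl_on_induct)
      case base show ?case by (rule subtree_refl)
    next
      case (step y z)
      show ?case
      proof (rule ccontr)
        assume z: "z \<notin> subtree ?u"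
        have yz: "(?u, z) \<in> E" using subtree_exit[of y z ?u] step z by auto
        have "(z, ?u) \<notin> parent" using z by (auto simp: subtree_def)
        then have "z \<in> Cy" using E_cases[OF yz] uC by (auto simp: parent_iff)
        then show False using nbr' yz step by (auto simp: S_def)
      qed
    qed
  next
    fix v assume v: "v \<in> subtree ?u"
    have "(v, ?u) \<in> (E \<inter> subtree ?u \<times> subtree ?u)\<^sup>*" by (rule reach_subtree[OF v])
    then have r: "(v, ?u) \<in> rtrancl_on (subtree ?u) (E \<inter> subtree ?u \<times> subtree ?u)"
      using v subtree_refl by (rule rtrancl_consistent_rtrancl_on) auto
    have sub: "E \<inter> subtree ?u \<times> subtree ?u \<subseteq> E \<inter> S \<times> S" using DS by blast
    have "(v, ?u) \<in> rtrancl_on S (E \<inter> S \<times> S)" by (rule rtrancl_on_mono[OF sub DS r])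
    moreover have "sym (E \<inter> S \<times> S)" using sym_E by (auto intro: symI)
    ultimately have "(?u, v) \<in> rtrancl_on S (E \<inter> S \<times> S)" using rtrancl_on_sym by (metis symD)
    with \<open>(v, ?u) \<in> rtrancl_on S (E \<inter> S \<times> S)\<close> show "v \<in> pre_digraph.scc_of H ?u"
      by (simp add: pre_digraph.scc_of_def reachable_def ends vH)
  qed
  have "hanging_tree G s c i = H \<restriction> subtree ?u"
    unfolding hanging_tree_def Let_def G(1) S_def[symmetric] H_def[symmetric] scc ..
  also have "\<dots> = with_proj G \<restriction> subtree ?u"
    unfolding H_def induce_subgraph_def using DS by auto
  finally show ?thesis .
qed

end

section \<open>Agreement of mp-sets with position sets\<close>

lemma monophonic_path_iff:
  "monophonic_path G p \<longleftrightarrow> p \<noteq> [] \<and> induced_path (pverts G) (parcs G) p"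
  unfolding monophonic_path_def vpath_def vwalk_def induced_path_def set_vwalk_arcs_nth
  by auto

lemma mp_set_iff: "mp_set G M \<longleftrightarrow> position_set (pverts G) (parcs G) M"
proof
  assume M: "mp_set G M"
  show "position_set (pverts G) (parcs G) M"
    unfolding position_set_def
  proof (intro conjI allI impI notI)
    show "M \<subseteq> pverts G" using M by (simp add: mp_set_def)
    fix p i j k
    assume *: "induced_path (pverts G) (parcs G) p \<and> i < j \<and> j < k \<and> k < length p"
      and **: "p ! i \<in> M \<and> p ! j \<in> M \<and> p ! k \<in> M"
    then have "distinct p" by (simp add: induced_path_def)
    then have "card {p ! i, p ! j, p ! k} = 3" using * by (simp add: nth_eq_iff_index_eq)
    moreover have "monophonic_path G p" using * by (auto simp: monophonic_path_iff)
    moreover have "{p ! i, p ! j, p ! k} \<subseteq> set p" "{p ! i, p ! j, p ! k} \<subseteq> M" using * ** by auto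
    ultimately show False using M unfolding mp_set_def by blast
  qed
next
  assume M: "position_set (pverts G) (parcs G) M"
  show "mp_set G M"
    unfolding mp_set_def
  proof (intro conjI notI)
    show "M \<subseteq> pverts G" using M by (simp add: position_set_def)
    assume "\<exists>S p. S \<subseteq> M \<and> card S = 3 \<and> monophonic_path G p \<and> S \<subseteq> set p"
    then obtain x y z p where S: "{x, y, z} \<subseteq> M" "x \<noteq> y" "y \<noteq> z" "x \<noteq> z" "{x, y, z} \<subseteq> set p"
      and p: "induced_path (pverts G) (parcs G) p"
      by (auto simp: card_3_iff monophonic_path_iff)
    then obtain a b e where abe: "a < length p" "b < length p" "e < length p"
      "p ! a = x" "p ! b = y" "p ! e = z" by (auto simp: in_set_conv_nth)
    then have "a \<noteq> b" "b \<noteq> e" "a \<noteq> e" using S by auto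
    \<comment> \<open>All six orders of the three positions; each yields an increasing
      triple.\<close>
    then consider "a < b" "b < e" | "a < e" "e < b" | "b < a" "a < e" | "b < e" "e < a"
      | "e < a" "a < b" | "e < b" "b < a" by linarith
    moreover have *: False if "i < j" "j < k" "{i, j, k} \<subseteq> {a, b, e}" for i j k
    proof -
      have "p ! i \<in> M" "p ! j \<in> M" "p ! k \<in> M" "k < length p" using that(3) abe S(1) by auto
      then show False using M p that(1,2) unfolding position_set_def by meson
    qed
    ultimately show False by cases (erule (1) *, simp)+
  qed
qed

lemma out_degree_with_proj: "out_degree (with_proj G) v = card {w. (v, w) \<in> parcs G}"
proof -
  have "out_arcs (with_proj G) v = Pair v ` {w. (v, w) \<in> parcs G}" by (auto simp: image_iff)
  then show ?thesis by (simp add: out_degree_def card_image inj_on_def)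
qed

section \<open>Unicyclic graphs are cycles with hanging trees\<close>

lemma unicyclic_cycle_with_trees:
  assumes uni: "unicyclic G" and C: "cycle_of G C" and lab: "cyclic_labelling s c C"
  obtains par d where "cycle_with_trees (pverts G) (parcs G) s c par d"
proof -
  interpret pair_graph G using uni by (simp add: unicyclic_def)
  define V where "V = pverts G"
  define E where "E = parcs G"
  define Cy where "Cy = c ` {0..<s}"
  define Z where "Z = symcl ((\<lambda>i. (c i, c ((i + 1) mod s))) ` {0..<s})"
  have s3: "3 \<le> s" and inj: "inj_on c {0..<s}" and C_eq: "pverts C = Cy" "parcs C = Z"
    using lab by (auto simp: cyclic_labelling_def cycle_graph_def Cy_def Z_def)
  have CyV: "Cy \<subseteq> V" and ZE: "Z \<subseteq> E"
    using C C_eq by (auto simp: cycle_of_def subgraph_def V_def E_def)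
  have fin: "finite V" using pair_finite_verts by (simp add: V_def)
  have EV: "E \<subseteq> V \<times> V" using wellformed' by (auto simp: E_def V_def)
  have symE: "(v, u) \<in> E" if "(u, v) \<in> E" for u v
    using arcs_symmetric that by (simp add: E_def)
  have irrE: "(v, v) \<notin> E" for v using no_loops' by (auto simp: E_def)
  have conn: "(u, v) \<in> E\<^sup>*" if "u \<in> V" "v \<in> V" for u v
  proof -
    have "Digraph_Component.connected (with_proj G)" using uni by (simp add: unicyclic_def)
    then have "(u, v) \<in> rtrancl_on (pverts G) (symcl (parcs G))"
      using that by (simp add: connected_conv V_def)
    then have "(u, v) \<in> (symcl (parcs G))\<^sup>*" by (rule rtrancl_on_rtranclI)
    moreover have "symcl (parcs G) = E" using symE by (auto simp: symcl_def E_def)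
    ultimately show ?thesis by simp
  qed
  have c0: "c 0 \<in> Cy" using s3 by (auto simp: Cy_def)
  \<comment> \<open>The distance to the cycle; the first edge of a shortest walk gives a neighbour
    of smaller distance, to be used as parent.\<close>
  define d where "d v = (LEAST n. \<exists>u\<in>Cy. (v, u) \<in> E ^^ n)" for v
  have "\<exists>w. (v, w) \<in> E \<and> d w < d v" if v: "v \<in> V - Cy" for v
  proof -
    have "(v, c 0) \<in> E\<^sup>*" using conn v c0 CyV by blast
    then have "\<exists>n. \<exists>u\<in>Cy. (v, u) \<in> E ^^ n" using c0 by (auto simp: rtrancl_power)
    then have "\<exists>u\<in>Cy. (v, u) \<in> E ^^ d v" unfolding d_def by (rule LeastI_ex)
    then obtain u where u: "u \<in> Cy" "(v, u) \<in> E ^^ d v" by blast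
    have "d v \<noteq> 0"
    proof
      assume "d v = 0"
      with u v show False by simp
    qed
    then obtain m where m: "d v = Suc m" by (cases "d v") auto
    then have "(v, u) \<in> E ^^ Suc m" using u by simp
    then obtain w where w: "(v, w) \<in> E" "(w, u) \<in> E ^^ m" by (blast dest: relpow_Suc_D2)
    have "d w \<le> m" unfolding d_def by (rule Least_le) (use u w in blast)
    then show ?thesis using w m by auto
  qed
  then obtain par where par: "\<And>v. v \<in> V - Cy \<Longrightarrow> (v, par v) \<in> E \<and> d (par v) < d v"
    by metis
  define T where "T = symcl ((\<lambda>v. (v, par v)) ` (V - Cy))"
  \<comment> \<open>The edges accounted for so far. They connect every vertex to \<open>c 0\<close>,
    and it remains to exclude any other edge.\<close>
  define S where "S = Z \<union> T"
  have TE: "T \<subseteq> E" using par symE by (auto simp: T_def symcl_def)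
  then have SE: "S \<subseteq> E" using ZE by (simp add: S_def)
  have symS: "sym S" by (auto intro!: symI simp: S_def T_def Z_def symcl_def image_iff)
  have cyc0: "(c i, c 0) \<in> S\<^sup>*" if "i < s" for i
    using that
  proof (induction i)
    case (Suc i)
    have "(c (Suc i), c i) \<in> S" using Suc.prems by (force simp: S_def Z_def symcl_def image_iff)
    then show ?case using Suc by (auto intro: converse_rtrancl_into_rtrancl)
  qed auto
  have to0: "(v, c 0) \<in> S\<^sup>*" if "v \<in> V" for v
    using that
  proof (induction "d v" arbitrary: v rule: less_induct)
    case less
    show ?case
    proof (cases "v \<in> Cy")
      case True then show ?thesis using cyc0 by (auto simp: Cy_def)
    next
      case False
      then have "(v, par v) \<in> S" "par v \<in> V" "d (par v) < d v"
        using less.prems par[of v] EV by (auto simp: S_def T_def symcl_def)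
      then show ?thesis using less.hyps by (meson converse_rtrancl_into_rtrancl)
    qed
  qed
  \<comment> \<open>An edge outside \<open>S\<close>, together with a path in \<open>S\<close>
    between its ends, forms a cycle. It differs from \<open>C\<close>, whose edges all lie in
    \<open>S\<close>.\<close>
  have "E \<subseteq> S"
  proof (rule subrelI, rule ccontr)
    fix u v assume uv: "(u, v) \<in> E" "(u, v) \<notin> S"
    then have uvV: "u \<in> V" "v \<in> V" using EV by auto
    have "(c 0, u) \<in> S\<^sup>*" using to0[OF uvV(1)] symS by (meson sym_rtrancl symD)
    then have "(v, u) \<in> S\<^sup>*" using to0[OF uvV(2)] by (meson rtrancl_trans)
    moreover have "S \<inter> V \<times> V = S" using SE EV by blast
    ultimately have "(v, u) \<in> (S \<inter> V \<times> V)\<^sup>*" by simp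
    moreover have "(w, w) \<notin> S" for w using SE irrE by blast
    ultimately obtain p where p: "induced_path V S p" "p \<noteq> []" "hd p = v" "last p = u"
      using shortest_walk_induced[of S V V v u] symS uvV by blast
    define n where "n = length p"
    have h: "p ! 0 = v" "p ! (n - 1) = u"
      using p by (auto simp: n_def hd_conv_nth last_conv_nth)
    have step: "(p ! i, p ! Suc i) \<in> S" if "Suc i < n" for i
      using p that by (simp add: induced_path_def n_def)
    have "n \<noteq> 0" using p by (simp add: n_def)
    moreover have "n \<noteq> 1" using h uv irrE by auto
    moreover have "n \<noteq> 2"
    proof
      assume "n = 2"
      then have "(v, u) \<in> S" using step[of 0] h by simp
      then show False using uv symS by (meson symD)
    qed
    \<comment> \<open>One vertex would make the edge a loop, two would put it into
      \<open>S\<close>.\<close>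
    ultimately have n3: "3 \<le> n" by linarith
    \<comment> \<open>The wrap-around from index \<open>n - 1\<close> to 0 is the edge from
      \<open>u\<close> to \<open>v\<close>.\<close>
    define C' where "C' = cycle_graph n (\<lambda>i. p ! i)"
    have dist: "distinct p" and pV: "set p \<subseteq> V" using p by (auto simp: induced_path_def)
    then have "inj_on (\<lambda>i. p ! i) {0..<n}" by (auto simp: inj_on_def n_def nth_eq_iff_index_eq)
    then have "is_cycle C'" using n3 unfolding is_cycle_def cyclic_labelling_def C'_def by blast
    have C'V: "pverts C' \<subseteq> V" using pV by (auto simp: C'_def cycle_graph_def n_def)
    have edge: "(p ! i, p ! ((i + 1) mod n)) \<in> E" if "i < n" for i
    proof (cases "Suc i = n")
      case True
      then have "i = n - 1" by simp
      then show ?thesis using h uv True by simp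
    next
      case False
      then show ?thesis using that step[of i] SE by auto
    qed
    then have C'E: "parcs C' \<subseteq> E" using symE by (auto simp: C'_def cycle_graph_def symcl_def)
    have "pair_wf_digraph C'"
      by unfold_locales (auto simp: C'_def cycle_graph_def symcl_def)
    then have "subgraph (with_proj C') (with_proj G)"
      using C'V C'E wf_digraph_axioms
      by (auto simp: subgraph_def V_def E_def wf_digraph_wp_iff)
    then have "cycle_of G C'" using \<open>is_cycle C'\<close> by (simp add: cycle_of_def)
    then have "C' = C" using uni C unfolding unicyclic_def by blast
    moreover have "(u, v) \<in> parcs C'"
    proof -
      have "(p ! (n - 1), p ! ((n - 1 + 1) mod n)) \<in> parcs C'"
        unfolding C'_def cycle_graph_def symcl_def using n3 by auto
      then show ?thesis using h n3 by simp
    qed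
    ultimately show False using C_eq uv by (simp add: S_def)
  qed
  then have "E = S" using SE by blast
  have "cycle_with_trees V E s c par d"
    unfolding cycle_with_trees_def
  proof (intro conjI allI impI)
    show "E = symcl ((\<lambda>i. (c i, c ((i + 1) mod s))) ` {0..<s}) \<union>
       symcl ((\<lambda>v. (v, par v)) ` (V - c ` {0..<s}))"
      using \<open>E = S\<close> by (simp add: S_def Z_def T_def Cy_def)
    show "par v \<in> V" "d (par v) < d v" if "v \<in> V - c ` {0..<s}" for v
      using par[of v] that EV by (auto simp: Cy_def)
  qed (use fin s3 inj CyV in \<open>auto simp: Cy_def\<close>)
  then show ?thesis using that by (simp add: V_def E_def)
qed

section \<open>The formula in terms of cycle indices\<close>

theorem theorem3p5:
  fixes G C :: "'a pair_pre_digraph" and c :: "nat \<Rightarrow> 'a" and s :: nat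
  assumes "unicyclic G" and "\<not> is_cycle G"
    and "cycle_of G C" and "cyclic_labelling s c C"
  shows
    "let R = branch_indices G s c;
         r = card R;
         T = hanging_tree G s c
     in mp G =
       (if r = 1 then num_leaves G + 2
        else if r = 2 \<and> (\<exists>i j. R = {i, j} \<and> (is_path_from (c i) (T i) \<or> is_path_from (c j) (T j)))
          then num_leaves G + 1
        else if r = 2 \<and> (\<exists>i \<in> {0..<s}. R = {i, (i + 1) mod s}) then num_leaves G + 1
        else num_leaves G)"
proof -
  obtain par d where "cycle_with_trees (pverts G) (parcs G) s c par d"
    using unicyclic_cycle_with_trees[OF assms(1,3,4)] .
  then interpret cycle_with_trees "pverts G" "parcs G" s c par d .
  \<comment> \<open>\<open>B\<close> holds indices and \<open>R\<close> vertices; \<open>c\<close>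
    is a bijection between them.\<close>
  define B where "B = branch_indices G s c"
  have B_iff: "i \<in> B \<longleftrightarrow> i < s \<and> c i \<in> R" for i
    using card_nbrs_cyc[of "c i"] by (auto simp: B_def branch_indices_def out_degree_with_proj)
  have cB: "c ` B = R" using R_sub by (auto simp: B_iff)
  have Bs: "B \<subseteq> {0..<s}" by (auto simp: B_iff)
  have card_B: "card B = card R" using card_image[OF inj_on_subset[OF inj Bs]] cB by simp
  have num_leaves_eq: "num_leaves G = card leaves"
  proof -
    have "{v \<in> pverts G. out_degree (with_proj G) v = 1} = leaves"
      using card_nbrs_eq_1 by (auto simp: out_degree_with_proj leaves_def)
    then show ?thesis by (simp add: num_leaves_def)
  qed
  \<comment> \<open>Without branch vertices every vertex lies on the cycle, and \<open>G\<close>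
    would be that cycle.\<close>
  have "R \<noteq> {}"
  proof
    assume "R = {}"
    then have V: "pverts G = Cy" using root_in_R cyc_V by blast
    have "parcs G = symcl ((\<lambda>i. (c i, c ((i + 1) mod s))) ` {0..<s})"
      using E_eq unfolding V by (simp add: symcl_def)
    then have "G = cycle_graph s c" using V by (simp add: cycle_graph_def)
    then show False using assms(2) s3 inj unfolding is_cycle_def cyclic_labelling_def by blast
  qed
  then have mp: "mp G = mp_value" using Max_position_set by (simp add: mp_def mp_set_iff)
  have path: "is_path_from (c i) (hanging_tree G s c i) \<longleftrightarrow> card (leaves \<inter> subtree (c i)) = 1" if "i \<in> B" for i
    using that hanging_tree_eq[of G i] is_path_from_iff[of G "c i"] by (simp add: B_iff)
  have pair: "\<exists>j. B = {i, j}" if "card B = 2" "i \<in> B" for i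
    using that by (metis card_2_iff insertE insert_commute singletonD)
  have path_iff: "(\<exists>i j. B = {i, j} \<and> (is_path_from (c i) (hanging_tree G s c i) \<or>
      is_path_from (c j) (hanging_tree G s c j))) \<longleftrightarrow> (\<exists>u\<in>R. card (leaves \<inter> subtree u) = 1)"
    if "card B = 2"
  proof
    assume "\<exists>i j. B = {i, j} \<and> (is_path_from (c i) (hanging_tree G s c i) \<or>
      is_path_from (c j) (hanging_tree G s c j))"
    then obtain i where "i \<in> B" "is_path_from (c i) (hanging_tree G s c i)" by blast
    then show "\<exists>u\<in>R. card (leaves \<inter> subtree u) = 1" using path B_iff by blast
  next
    assume "\<exists>u\<in>R. card (leaves \<inter> subtree u) = 1"
    then have "\<exists>i\<in>B. card (leaves \<inter> subtree (c i)) = 1" unfolding cB[symmetric] by simp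
    then obtain i where i: "i \<in> B" "card (leaves \<inter> subtree (c i)) = 1" by blast
    from pair[OF that i(1)] obtain j where "B = {i, j}" by blast
    with i path[OF i(1)] show "\<exists>i j. B = {i, j} \<and> (is_path_from (c i) (hanging_tree G s c i) \<or>
      is_path_from (c j) (hanging_tree G s c j))"
      by metis
  qed
  have adj_iff: "(\<exists>i\<in>{0..<s}. B = {i, (i + 1) mod s}) \<longleftrightarrow> (\<exists>u\<in>R. \<exists>v\<in>R. (u, v) \<in> parcs G)"
    if "card B = 2"
  proof
    assume "\<exists>i\<in>{0..<s}. B = {i, (i + 1) mod s}"
    then obtain i where i: "i < s" "B = {i, (i + 1) mod s}" by auto
    then have "(c i, c ((i + 1) mod s)) \<in> parcs G" using cyc_succ[of i "(i + 1) mod s"] by simp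
    moreover have "c i \<in> R" "c ((i + 1) mod s) \<in> R" using i B_iff by blast+
    ultimately show "\<exists>u\<in>R. \<exists>v\<in>R. (u, v) \<in> parcs G" by blast
  next
    assume "\<exists>u\<in>R. \<exists>v\<in>R. (u, v) \<in> parcs G"
    then have "\<exists>i\<in>B. \<exists>j\<in>B. (c i, c j) \<in> parcs G" unfolding cB[symmetric] by simp
    then obtain i j where ij: "i \<in> B" "j \<in> B" "(c i, c j) \<in> parcs G" by blast
    then have ne: "i \<noteq> j" using irrefl_E by auto
    have "finite B" using Bs finite_subset by blast
    then have B: "B = {i, j}" using ij ne that by (intro card_subset_eq[symmetric]) auto
    \<comment> \<open>Either index may be the predecessor of the other, so the witness is
      \<open>i\<close> or \<open>j\<close>.\<close>
    have "j = (i + 1) mod s \<or> i = (j + 1) mod s" using ij cyc_succ[of i j] by (simp add: B_iff)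
    then show "\<exists>i\<in>{0..<s}. B = {i, (i + 1) mod s}"
    proof
      assume "j = (i + 1) mod s"
      then have "B = {i, (i + 1) mod s}" using B by simp
      then show ?thesis using ij(1) Bs by blast
    next
      assume "i = (j + 1) mod s"
      then have "B = {j, (j + 1) mod s}" using B by auto
      then show ?thesis using ij(2) Bs by blast
    qed
  qed
  show ?thesis
  proof (cases "card B = 2")
    case True
    then show ?thesis
      unfolding Let_def B_def[symmetric] mp mp_value_def num_leaves_eq path_iff[OF True] adj_iff[OF True]
      by (auto simp: card_B)
  next
    case False
    then show ?thesis
      unfolding Let_def B_def[symmetric] mp mp_value_def num_leaves_eq by (simp add: card_B)
  qed
qed

end
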